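(* Let $M$ be a vector space over $\mathbb K$ and $\beta\colon M\to M$ a linear map. The pair $(C_\beta(M),\circ_l)$ is a graded pre-Lie algebra, i.e. for all $f\in C^m_\beta(M)$, $g\in C^n_\beta(M)$, $h\in C^p_\beta(M)$, $$(f\circ_l g)\circ_l h-f\circ_l(g\circ_l h)=(-1)^{(n-1)(p-1)}\bigl((f\circ_l h)\circ_l g-f\circ_l(h\circ_l g)\bigr).$$
   Context: $\mathbb K$ is a field of characteristic zero. For $k\ge1$, $C^k_\beta(M)$ is the space of linear maps $f\colon M^{\otimes k}\to M$ with $\beta\circ f=f\circ\beta^{\otimes k}$, placed in degree $k-1$, and $C_\beta(M)=\bigoplus_{k\ge1}C^k_\beta(M)$. $\mathrm{Sh}(p,q)$ is the set of permutations $\sigma\in S_{p+q}$ with $\sigma(1)<\dots<\sigma(p)$ and $\sigma(p+1)<\dots<\sigma(p+q)$; $\epsilon(\sigma)$ is the signature. For $\sigma\in\mathrm{Sh}(p,q)$ put $l(\sigma)=1$ if $\sigma(p)<\sigma(p+1)$ (or $q=0$) and $l(\sigma)=i$ if $\sigma(p+1)<\dots<\sigma(p+i-1)<\sigma(p)<\sigma(p+i)<\dots<\sigma(p+q)$; that is, $l(\sigma)=1+\#\{j\in\{1,\dots,q\}:\sigma(p+j)<\sigma(p)\}\in\{1,\dots,q+1\}$. For $f\in C^m_\beta(M)$, $g\in C^n_\beta(M)$, the product $f\circ_l g\in C^{m+n-1}_\beta(M)$ is $$f\circ_l g(a_1,\dots,a_{m+n-1})=\sum_{\sigma\in\mathrm{Sh}(n,m-1)}(-1)^{l(\sigma)-1}\epsilon(\sigma)\,f\bigl(\beta^{n-1}(a_{\sigma(n+1)}),\dots,\beta^{n-1}(a_{\sigma(n+i-1)}),g(a_{\sigma(1)},\dots,a_{\sigma(n)}),\beta^{n-1}(a_{\sigma(n+i)}),\dots,\beta^{n-1}(a_{\sigma(m+n-1)})\bigr),$$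 where $i=l(\sigma)$ in each summand. *)

theory Defs
  imports Complex_Main "HOL-Library.Function_Algebras" "HOL-Combinatorics.Permutations"
begin

text \<open>
  A linear map from the \<open>k\<close>-th tensor power of \<open>M\<close> to \<open>M\<close> is rendered, by the universal
  property, as a \<open>k\<close>-linear function on argument lists of length \<open>k\<close>. The list
  \<open>[a\<^sub>1, \<dots>, a\<^sub>k]\<close> is indexed from \<open>0\<close>, so \<open>a\<^sub>j\<close> is \<open>as ! (j - 1)\<close>.
\<close>

definition multilinear_on_lists ::
  "('k::field \<Rightarrow> 'm::ab_group_add \<Rightarrow> 'm) \<Rightarrow> nat \<Rightarrow> ('m list \<Rightarrow> 'm) \<Rightarrow> bool" where
  "multilinear_on_lists scale k f \<longleftrightarrow>
     (\<forall>as i. length as = k \<longrightarrow> i < k \<longrightarrow>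
        Vector_Spaces.linear scale scale (\<lambda>x. f (as[i := x])))"

text \<open>
  Cochains of arity \<open>k\<close> are made to vanish on lists of any other length. Thus equality of
  functions is equality of multilinear maps, and cochains of different arities live in the one
  vector space \<open>'m list \<Rightarrow> 'm\<close>, where the sum over all arities is direct.
\<close>

definition cochains ::
  "('k::field \<Rightarrow> 'm::ab_group_add \<Rightarrow> 'm) \<Rightarrow> ('m \<Rightarrow> 'm) \<Rightarrow> nat \<Rightarrow> ('m list \<Rightarrow> 'm) set" where
  "cochains scale \<beta> k =
     {f. (\<forall>as. length as \<noteq> k \<longrightarrow> f as = 0) \<and>
         multilinear_on_lists scale k f \<and>
         (\<forall>as. length as = k \<longrightarrow> \<beta> (f as) = f (map \<beta> as))}"

definition fun_scale :: "('k \<Rightarrow> 'm \<Rightarrow> 'm) \<Rightarrow> 'k \<Rightarrow> ('x \<Rightarrow> 'm) \<Rightarrow> 'x \<Rightarrow> 'm" where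
  "fun_scale scale c f = (\<lambda>x. scale c (f x))"

definition Sh :: "nat \<Rightarrow> nat \<Rightarrow> (nat \<Rightarrow> nat) set" where
  "Sh p q = {\<sigma>. \<sigma> permutes {1..p + q} \<and>
                 strict_mono_on {1..p} \<sigma> \<and> strict_mono_on {p + 1..p + q} \<sigma>}"

definition shuffle_pos :: "nat \<Rightarrow> nat \<Rightarrow> (nat \<Rightarrow> nat) \<Rightarrow> nat" where
  "shuffle_pos p q \<sigma> = 1 + card {j \<in> {1..q}. \<sigma> (p + j) < \<sigma> p}"

definition circ_l ::
  "('k::field \<Rightarrow> 'm::ab_group_add \<Rightarrow> 'm) \<Rightarrow> ('m \<Rightarrow> 'm) \<Rightarrow> nat \<Rightarrow> nat \<Rightarrow>
   ('m list \<Rightarrow> 'm) \<Rightarrow> ('m list \<Rightarrow> 'm) \<Rightarrow> 'm list \<Rightarrow> 'm" where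
  "circ_l scale \<beta> m n f g as =
     (if length as = m + n - 1 then
        \<Sum>\<sigma>\<in>Sh n (m - 1).
          let i = shuffle_pos n (m - 1) \<sigma>;
              a = (\<lambda>j. as ! (\<sigma> j - 1))
          in scale ((- 1) ^ (i - 1) * of_int (sign \<sigma>))
               (f (map (\<lambda>j. (\<beta> ^^ (n - 1)) (a j)) [n + 1..<n + i]
                   @ [g (map a [1..<n + 1])]
                   @ map (\<lambda>j. (\<beta> ^^ (n - 1)) (a j)) [n + i..<m + n]))
      else 0)"

text \<open>
  The bilinear extension to the direct sum: on a list of length \<open>N\<close>, the contributing pairs of
  arities \<open>m, n \<ge> 1\<close> are those with \<open>m + n - 1 = N\<close>. No explicit projections are needed, since
  \<open>circ_l\<close> evaluates its arguments only on lists of length \<open>m\<close> and \<open>n\<close>, respectively.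
\<close>

definition circ_total ::
  "('k::field \<Rightarrow> 'm::ab_group_add \<Rightarrow> 'm) \<Rightarrow> ('m \<Rightarrow> 'm) \<Rightarrow>
   ('m list \<Rightarrow> 'm) \<Rightarrow> ('m list \<Rightarrow> 'm) \<Rightarrow> 'm list \<Rightarrow> 'm" where
  "circ_total scale \<beta> F G as =
     (\<Sum>n\<in>{1..length as}. circ_l scale \<beta> (length as + 1 - n) n F G as)"

text \<open>
  The underlying space of the algebra is the internal direct sum of the subspaces \<open>V d\<close>,
  \<open>d \<ge> 0\<close> (that is, their span); \<open>mult\<close> is irrelevant outside it.
\<close>

locale graded_pre_Lie_algebra = vector_space scale
  for scale :: "'k::field \<Rightarrow> 'v::ab_group_add \<Rightarrow> 'v" +
  fixes V :: "nat \<Rightarrow> 'v set"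
    and mult :: "'v \<Rightarrow> 'v \<Rightarrow> 'v"
  assumes subspace_component: "subspace (V d)"
    and direct: "finite D \<Longrightarrow> (\<And>d. d \<in> D \<Longrightarrow> v d \<in> V d) \<Longrightarrow> (\<Sum>d\<in>D. v d) = 0 \<Longrightarrow>
                 d \<in> D \<Longrightarrow> v d = 0"
    and mult_add_left: "x \<in> span (\<Union>d. V d) \<Longrightarrow> x' \<in> span (\<Union>d. V d) \<Longrightarrow>
                 y \<in> span (\<Union>d. V d) \<Longrightarrow> mult (x + x') y = mult x y + mult x' y"
    and mult_add_right: "x \<in> span (\<Union>d. V d) \<Longrightarrow> y \<in> span (\<Union>d. V d) \<Longrightarrow>
                 y' \<in> span (\<Union>d. V d) \<Longrightarrow> mult x (y + y') = mult x y + mult x y'"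
    and mult_scale_left: "x \<in> span (\<Union>d. V d) \<Longrightarrow> y \<in> span (\<Union>d. V d) \<Longrightarrow>
                 mult (scale c x) y = scale c (mult x y)"
    and mult_scale_right: "x \<in> span (\<Union>d. V d) \<Longrightarrow> y \<in> span (\<Union>d. V d) \<Longrightarrow>
                 mult x (scale c y) = scale c (mult x y)"
    and mult_degree: "x \<in> V d \<Longrightarrow> y \<in> V e \<Longrightarrow> mult x y \<in> V (d + e)"
    and pre_Lie: "x \<in> V d \<Longrightarrow> y \<in> V e \<Longrightarrow> z \<in> V r \<Longrightarrow>
                 mult (mult x y) z - mult x (mult y z) =
                 scale ((- 1) ^ (e * r)) (mult (mult x z) y - mult x (mult z y))"

end

theory Submission
  imports Defs
begin

text \<open>
  Put \<open>N = m + n - 1\<close>. A shuffle \<open>\<sigma> \<in> Sh n (m - 1)\<close> is determined by the set \<open>S = \<sigma> ` {1..n}\<close>,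
  which may be any \<open>n\<close>-element subset of \<open>{1..N}\<close>, and the definition of \<open>l(\<sigma>)\<close> says that
  \<open>g(a\<^sub>S)\<close> is inserted exactly where the argument with index \<open>Max S\<close> would stand. The number
  \<open>l(\<sigma>) - 1\<close> counts the pairs \<open>(Max S, t)\<close> with \<open>t \<notin> S\<close> and \<open>t < Max S\<close>, while the signature is the
  parity of all pairs \<open>(s, t)\<close> with \<open>s \<in> S\<close>, \<open>t \<notin> S\<close> and \<open>t < s\<close>. The pairs with \<open>s = Max S\<close> cancel. Writing
  \<open>lower S = S - {Max S}\<close>, the summand thus has the sign of the shuffle that brings
  \<open>lower S\<close> in front of its complement, and the product reads: choose \<open>S\<close>, delete the arguments at
  \<open>lower S\<close>, overwrite the one at \<open>Max S\<close> by \<open>g(a\<^sub>S)\<close>, apply \<open>\<beta>\<^sup>n\<^sup>-\<^sup>1\<close> to the others, and apply \<open>f\<close>.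
  In this form (\<open>subset_comp\<close>, \<open>eval_on_circ_l\<close>) the positions may be any finite set of naturals,
  so that the product can be iterated without renumbering.

  Over a set \<open>R\<close> of positions, \<open>(f \<circ> g) \<circ> h\<close> expands into a sum over a block \<open>S \<subseteq> R\<close> for \<open>h\<close> and then
  a block \<open>U \<subseteq> R - lower S\<close> for \<open>g\<close>. If \<open>Max S \<in> U\<close>, the value of \<open>h\<close> is an argument of \<open>g\<close>; the pair
  \<open>(S, U)\<close> corresponds to the nested pair \<open>S \<subseteq> V = U \<union> S\<close>, and these terms add up to
  \<open>f \<circ> (g \<circ> h)\<close>, with equal crossing numbers (\<open>nested_blocks\<close>). The point is
  that \<open>Max V = Max U\<close> and \<open>lower V = lower U \<union> lower S\<close>. If \<open>Max S \<notin> U\<close>, then \<open>S\<close> and \<open>U\<close> are disjoint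
  and \<open>g\<close>, \<open>h\<close> are inserted side by side. So the associator is the sum \<open>parallel_comp\<close> over disjoint
  pairs (\<open>associator_eq_parallel_comp\<close>). Exchanging \<open>g\<close> and \<open>h\<close> only replaces the crossings of
  \<open>lower S\<close> with \<open>lower U\<close> by those of \<open>lower U\<close> with \<open>lower S\<close>; together these are all
  \<open>(p - 1)(n - 1)\<close> pairs, which is the sign in the pre-Lie identity (\<open>parallel_comp_swap\<close>).
\<close>

section \<open>Signature and inversions\<close>

lemma strict_mono_onI_Suc:
  fixes \<sigma> :: "nat \<Rightarrow> nat"
  assumes "\<And>k. a \<le> k \<Longrightarrow> k < b \<Longrightarrow> \<sigma> k < \<sigma> (Suc k)"
  shows "strict_mono_on {a..b} \<sigma>"
proof (rule strict_mono_onI)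
  fix i j assume ij: "i \<in> {a..b}" "j \<in> {a..b}" "i < j"
  have "Suc i \<le> j" using ij by simp
  then have "j \<le> b \<longrightarrow> \<sigma> i < \<sigma> j"
  proof (induction j rule: dec_induct)
    case base
    show ?case using assms ij by auto
  next
    case (step n)
    have "a \<le> n" using step ij by simp
    then show ?case using step assms[of n] by auto
  qed
  then show "\<sigma> i < \<sigma> j" using ij by simp
qed

lemma sorted_list_of_set_image_strict_mono:
  fixes \<phi> :: "nat \<Rightarrow> nat"
  assumes "finite A" "strict_mono_on A \<phi>"
  shows "sorted_list_of_set (\<phi> ` A) = map \<phi> (sorted_list_of_set A)"
proof (rule strict_sorted_equal)
  show "sorted_wrt (<) (sorted_list_of_set (\<phi> ` A))" by simp
  have "sorted_wrt (\<lambda>x y. \<phi> x < \<phi> y) (sorted_list_of_set A)"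
    by (rule sorted_wrt_mono_rel[of _ "(<)"])
       (use assms in \<open>auto dest: strict_mono_onD\<close>)
  then show "sorted_wrt (<) (map \<phi> (sorted_list_of_set A))" by (simp add: sorted_wrt_map)
  show "set (sorted_list_of_set (\<phi> ` A)) = set (map \<phi> (sorted_list_of_set A))"
    using assms by simp
qed

lemma sorted_list_of_set_atLeastAtMost_1: "sorted_list_of_set {1..k} = [1..<k + 1]"
  by (metis Suc_eq_plus1 atLeastLessThanSuc_atLeastAtMost sorted_list_of_set_range)

lemma permutes_strict_mono_imp_id:
  fixes \<sigma> :: "nat \<Rightarrow> nat"
  assumes "\<sigma> permutes {a..b}" "strict_mono_on {a..b} \<sigma>"
  shows "\<sigma> = id"
proof
  fix x
  have "map \<sigma> (sorted_list_of_set {a..b}) = sorted_list_of_set {a..b}"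
    using sorted_list_of_set_image_strict_mono[OF _ assms(2)] permutes_image[OF assms(1)] by simp
  then have "map \<sigma> (sorted_list_of_set {a..b}) = map id (sorted_list_of_set {a..b})" by simp
  then have "\<forall>x\<in>{a..b}. \<sigma> x = id x" by (simp only: map_eq_conv) simp
  then show "\<sigma> x = id x" using permutes_not_in[OF assms(1)] by (cases "x \<in> {a..b}") auto
qed

definition inversions :: "nat set \<Rightarrow> (nat \<Rightarrow> nat) \<Rightarrow> (nat \<times> nat) set" where
  "inversions A \<sigma> = {(i, j). i \<in> A \<and> j \<in> A \<and> i < j \<and> \<sigma> j < \<sigma> i}"

lemma finite_inversions [simp]: "finite A \<Longrightarrow> finite (inversions A \<sigma>)"
  by (rule finite_subset[of _ "A \<times> A"]) (auto simp: inversions_def)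

text \<open>
  Composing with the transposition of neighbouring positions \<open>k\<close> and \<open>k + 1\<close> preserves the order of every
  pair of positions except that one, so at a descent exactly one inversion disappears.
\<close>

lemma card_inversions_descent:
  assumes fin: "finite A" and \<sigma>: "\<sigma> permutes A" and k: "k \<in> A" "Suc k \<in> A"
    and desc: "\<sigma> (Suc k) < \<sigma> k"
  shows "card (inversions A \<sigma>) = Suc (card (inversions A (\<sigma> \<circ> transpose k (Suc k))))"
proof -
  let ?t = "transpose k (Suc k)"
  have mem: "?t i \<in> A \<longleftrightarrow> i \<in> A" for i
    using k by (auto simp: transpose_def)
  have less: "?t i < ?t j" if "i < j" "(i, j) \<noteq> (k, Suc k)" for i j
    using that by (auto simp: transpose_def)
  have tt: "?t (?t i) = i" for i by simp
  have "inversions A (\<sigma> \<circ> ?t) = map_prod ?t ?t ` (inversions A \<sigma> - {(k, Suc k)})"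
  proof (intro equalityI subsetI)
    fix x assume "x \<in> inversions A (\<sigma> \<circ> ?t)"
    then obtain i j where x: "x = (i, j)" "i \<in> A" "j \<in> A" "i < j" "\<sigma> (?t j) < \<sigma> (?t i)"
      by (auto simp: inversions_def)
    have ne: "(i, j) \<noteq> (k, Suc k)" using x desc by auto
    then have "(?t i, ?t j) \<in> inversions A \<sigma>"
      using x mem less by (auto simp: inversions_def)
    moreover have "(?t i, ?t j) \<noteq> (k, Suc k)"
    proof
      assume "(?t i, ?t j) = (k, Suc k)"
      then have "?t (?t i) = ?t k" "?t (?t j) = ?t (Suc k)" by simp_all
      then have "i = Suc k" "j = k" unfolding tt by simp_all
      then show False using x(4) by simp
    qed
    ultimately have "map_prod ?t ?t (?t i, ?t j) \<in> map_prod ?t ?t ` (inversions A \<sigma> - {(k, Suc k)})"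
      by blast
    then show "x \<in> map_prod ?t ?t ` (inversions A \<sigma> - {(k, Suc k)})" using x by simp
  next
    fix x assume "x \<in> map_prod ?t ?t ` (inversions A \<sigma> - {(k, Suc k)})"
    then obtain i j where "x = (?t i, ?t j)" "i \<in> A" "j \<in> A" "i < j" "\<sigma> j < \<sigma> i" "(i, j) \<noteq> (k, Suc k)"
      by (auto simp: inversions_def)
    then show "x \<in> inversions A (\<sigma> \<circ> ?t)"
      using mem less by (auto simp: inversions_def)
  qed
  moreover have "inj (map_prod ?t ?t)"
    by (simp add: prod.inj_map)
  ultimately have "card (inversions A (\<sigma> \<circ> ?t)) = card (inversions A \<sigma> - {(k, Suc k)})"
    using card_image[OF inj_on_subset[OF _ subset_UNIV]] by simp
  moreover have "(k, Suc k) \<in> inversions A \<sigma>" using k desc by (auto simp: inversions_def)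
  then have "card (inversions A \<sigma>) = Suc (card (inversions A \<sigma> - {(k, Suc k)}))"
    by (rule card.remove[OF finite_inversions[OF fin]])
  ultimately show ?thesis by simp
qed

text \<open>
  Bubble sort: as long as there is a descent, an adjacent transposition changes the sign and removes one
  inversion; a permutation without descents is the identity.
\<close>

lemma sign_eq_card_inversions:
  assumes "\<sigma> permutes {a..b::nat}"
  shows "sign \<sigma> = (- 1) ^ card (inversions {a..b} \<sigma>)"
  using assms
proof (induction "card (inversions {a..b} \<sigma>)" arbitrary: \<sigma> rule: less_induct)
  case less
  show ?case
  proof (cases "\<exists>k. a \<le> k \<and> k < b \<and> \<sigma> (Suc k) < \<sigma> k")
    case False
    have "\<sigma> k < \<sigma> (Suc k)" if "a \<le> k" "k < b" for k
    proof -
      have "\<sigma> k \<noteq> \<sigma> (Suc k)" using permutes_inj[OF less.prems] by (metis injD n_not_Suc_n)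
      then show ?thesis using False that by (meson linorder_neqE_nat)
    qed
    then have mono: "strict_mono_on {a..b} \<sigma>" by (rule strict_mono_onI_Suc)
    have "inversions {a..b} \<sigma> = {}"
      unfolding inversions_def using strict_mono_onD[OF mono] less_asym by blast
    then show ?thesis using permutes_strict_mono_imp_id[OF less.prems mono] by simp
  next
    case True
    then obtain k where k: "a \<le> k" "k < b" "\<sigma> (Suc k) < \<sigma> k" by blast
    let ?t = "transpose k (Suc k)"
    have t: "?t permutes {a..b}" using k by (intro permutes_swap_id) auto
    have card: "card (inversions {a..b} \<sigma>) = Suc (card (inversions {a..b} (\<sigma> \<circ> ?t)))"
      using k less.prems by (intro card_inversions_descent) auto
    have "sign (\<sigma> \<circ> ?t) = - sign \<sigma>"
      using less.prems t by (subst sign_compose) (auto simp: permutation_permutes sign_swap_id)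
    moreover have "sign (\<sigma> \<circ> ?t) = (- 1) ^ card (inversions {a..b} (\<sigma> \<circ> ?t))"
      using card by (intro less.hyps permutes_compose[OF t less.prems]) simp
    ultimately have "sign \<sigma> = - ((- 1) ^ card (inversions {a..b} (\<sigma> \<circ> ?t)))" by linarith
    then show ?thesis unfolding card by simp
  qed
qed

section \<open>Crossings and blocks\<close>

text \<open>
  For disjoint \<open>A\<close> and \<open>B\<close> this is the number of inversions of the shuffle that lists \<open>A\<close> in increasing order
  and then \<open>B\<close>. Additivity in both arguments makes the sign bookkeeping for iterated products mechanical.
\<close>

definition crossings :: "nat set \<Rightarrow> nat set \<Rightarrow> nat" where
  "crossings A B = card {(x, y) \<in> A \<times> B. y < x}"

lemma crossings_union_left:
  assumes "finite A" "finite B" "finite C" "A \<inter> B = {}"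
  shows "crossings (A \<union> B) C = crossings A C + crossings B C"
  unfolding crossings_def
proof (subst card_Un_disjoint[symmetric])
  show "finite {(x, y) \<in> A \<times> C. y < x}" "finite {(x, y) \<in> B \<times> C. y < x}"
    using assms by (auto intro: finite_subset[of _ "A \<times> C"] finite_subset[of _ "B \<times> C"])
qed (use assms in \<open>auto intro: arg_cong[where f = card]\<close>)

lemma crossings_union_right:
  assumes "finite A" "finite B" "finite C" "B \<inter> C = {}"
  shows "crossings A (B \<union> C) = crossings A B + crossings A C"
  unfolding crossings_def
proof (subst card_Un_disjoint[symmetric])
  show "finite {(x, y) \<in> A \<times> B. y < x}" "finite {(x, y) \<in> A \<times> C. y < x}"
    using assms by (auto intro: finite_subset[of _ "A \<times> B"] finite_subset[of _ "A \<times> C"])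
qed (use assms in \<open>auto intro: arg_cong[where f = card]\<close>)

lemma crossings_swap:
  assumes "finite A" "finite B" "A \<inter> B = {}"
  shows "crossings A B + crossings B A = card A * card B"
proof -
  have "card {(x, y) \<in> B \<times> A. y < x} = card {(x, y) \<in> A \<times> B. x < y}"
    by (rule bij_betw_same_card[of prod.swap]) (auto intro!: bij_betw_byWitness[of _ prod.swap])
  moreover have "card {(x, y) \<in> A \<times> B. y < x} + card {(x, y) \<in> A \<times> B. x < y} = card (A \<times> B)"
  proof (subst card_Un_disjoint[symmetric])
    have "{(x, y) \<in> A \<times> B. y < x} \<union> {(x, y) \<in> A \<times> B. x < y} = A \<times> B"
      using assms(3) by (auto simp: not_less le_less)
    then show "card ({(x, y) \<in> A \<times> B. y < x} \<union> {(x, y) \<in> A \<times> B. x < y}) = card (A \<times> B)"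
      by simp
  qed (use assms in \<open>auto intro: finite_subset[of _ "A \<times> B"]\<close>)
  ultimately show ?thesis by (simp add: crossings_def card_cartesian_product)
qed

lemma crossings_eq_0: "(\<And>x y. x \<in> A \<Longrightarrow> y \<in> B \<Longrightarrow> x \<le> y) \<Longrightarrow> crossings A B = 0"
  by (force simp: crossings_def card_eq_0_iff)

lemma crossings_image:
  assumes "strict_mono_on C \<phi>" "A \<subseteq> C" "B \<subseteq> C"
  shows "crossings (\<phi> ` A) (\<phi> ` B) = crossings A B"
proof -
  have inj: "inj_on \<phi> C" using assms(1) by (rule strict_mono_on_imp_inj_on)
  have less: "\<phi> y < \<phi> x \<longleftrightarrow> y < x" if "x \<in> A" "y \<in> B" for x y
    using that assms by (meson strict_mono_on_less subsetD)
  have "{(x, y) \<in> \<phi> ` A \<times> \<phi> ` B. y < x} = map_prod \<phi> \<phi> ` {(x, y) \<in> A \<times> B. y < x}"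
    using less by (auto simp: image_iff)
  moreover have "inj_on (map_prod \<phi> \<phi>) {(x, y) \<in> A \<times> B. y < x}"
    by (rule inj_on_subset[OF map_prod_inj_on[OF inj inj]]) (use assms in auto)
  ultimately show ?thesis by (simp add: crossings_def card_image)
qed

text \<open>
  The elements of a block that disappear from the set of positions when a value is inserted: the
  largest one stays and carries that value.
\<close>

definition lower :: "nat set \<Rightarrow> nat set" where
  "lower S = S - {Max S}"

abbreviation subsets_of_card :: "'a set \<Rightarrow> nat \<Rightarrow> 'a set set" where
  "subsets_of_card R n \<equiv> {S. S \<subseteq> R \<and> card S = n}"

lemma ShD:
  assumes "\<sigma> \<in> Sh n q"
  shows "\<sigma> permutes {1..n + q}" "strict_mono_on {1..n} \<sigma>" "strict_mono_on {n + 1..n + q} \<sigma>"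
  using assms by (auto simp: Sh_def)

section \<open>Shuffles as subsets\<close>

lemma bij_betw_Sh_subsets:
  "bij_betw (\<lambda>\<sigma>. \<sigma> ` {1..n}) (Sh n q) (subsets_of_card {1..n + q} n)"
proof (rule bij_betw_imageI)
  show "inj_on (\<lambda>\<sigma>. \<sigma> ` {1..n}) (Sh n q)"
  proof (rule inj_onI)
    fix \<sigma> \<tau> assume st: "\<sigma> \<in> Sh n q" "\<tau> \<in> Sh n q" "\<sigma> ` {1..n} = \<tau> ` {1..n}"
    have compl: "\<rho> ` {n + 1..n + q} = {1..n + q} - \<rho> ` {1..n}" if "\<rho> \<in> Sh n q" for \<rho>
    proof -
      have "{n + 1..n + q} = {1..n + q} - {1..n}" by auto
      then show ?thesis
        using permutes_inj[OF ShD(1)[OF that]] permutes_image[OF ShD(1)[OF that]]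
        by (simp add: image_set_diff)
    qed
    have list1: "map \<rho> (sorted_list_of_set {1..n}) = sorted_list_of_set (\<rho> ` {1..n})"
      and list2: "map \<rho> (sorted_list_of_set {n + 1..n + q}) = sorted_list_of_set ({1..n + q} - \<rho> ` {1..n})"
      if "\<rho> \<in> Sh n q" for \<rho>
      using sorted_list_of_set_image_strict_mono[OF finite_atLeastAtMost ShD(2)[OF that]]
        sorted_list_of_set_image_strict_mono[OF finite_atLeastAtMost ShD(3)[OF that]]
      unfolding compl[OF that] by (simp_all only:)
    have "map \<sigma> (sorted_list_of_set {1..n}) = map \<tau> (sorted_list_of_set {1..n})"
      by (simp only: list1[OF st(1)] list1[OF st(2)] st(3))
    then have eq1: "\<forall>x\<in>{1..n}. \<sigma> x = \<tau> x" by (simp only: map_eq_conv) simp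
    have "map \<sigma> (sorted_list_of_set {n + 1..n + q}) = map \<tau> (sorted_list_of_set {n + 1..n + q})"
      by (simp only: list2[OF st(1)] list2[OF st(2)] st(3))
    then have eq2: "\<forall>x\<in>{n + 1..n + q}. \<sigma> x = \<tau> x" by (simp only: map_eq_conv) simp
    show "\<sigma> = \<tau>"
    proof
      fix x
      consider "x \<in> {1..n}" | "x \<in> {n + 1..n + q}" | "x \<notin> {1..n + q}" by fastforce
      then show "\<sigma> x = \<tau> x"
        using eq1 eq2 permutes_not_in[OF ShD(1)[OF st(1)]] permutes_not_in[OF ShD(1)[OF st(2)]]
        by cases auto
    qed
  qed
  show "(\<lambda>\<sigma>. \<sigma> ` {1..n}) ` Sh n q = subsets_of_card {1..n + q} n"
  proof (intro equalityI subsetI)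
    fix S assume "S \<in> (\<lambda>\<sigma>. \<sigma> ` {1..n}) ` Sh n q"
    then obtain \<sigma> where s: "\<sigma> \<in> Sh n q" "S = \<sigma> ` {1..n}" by blast
    have "S \<subseteq> \<sigma> ` {1..n + q}" using s by auto
    moreover have "card S = n"
      using s by (simp add: card_image inj_on_subset[OF permutes_inj[OF ShD(1)]])
    ultimately show "S \<in> subsets_of_card {1..n + q} n"
      using permutes_image[OF ShD(1)[OF s(1)]] by simp
  next
    fix S assume S: "S \<in> subsets_of_card {1..n + q} n"
    let ?T = "{1..n + q} - S"
    have fin: "finite S" using S finite_subset[of S "{1..n + q}"] by auto
    have cT: "card ?T = q" using S fin by (simp add: card_Diff_subset)
    \<comment> \<open>The shuffle with first block \<open>S\<close> lists \<open>S\<close> and then its complement; positions are shifted by one.\<close>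
    let ?xs = "sorted_list_of_set S @ sorted_list_of_set ?T"
    define \<sigma> where "\<sigma> j = (if j \<in> {1..n + q} then ?xs ! (j - 1) else j)" for j
    have len: "length ?xs = n + q" using S cT by simp
    have dist: "distinct ?xs" using fin by auto
    have set: "set ?xs = {1..n + q}" using S fin by auto
    have "bij_betw (\<lambda>j. j - 1) {1..n + q} {..<n + q}"
      by (rule bij_betw_byWitness[of _ Suc]) auto
    moreover have "bij_betw ((!) ?xs) {..<n + q} {1..n + q}"
      using bij_betw_nth[OF dist, of "{..<n + q}" "{1..n + q}"] len set by simp
    ultimately have "bij_betw ((!) ?xs \<circ> (\<lambda>j. j - 1)) {1..n + q} {1..n + q}"
      by (rule bij_betw_trans)
    then have "bij_betw \<sigma> {1..n + q} {1..n + q}"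
      by (rule bij_betw_cong[THEN iffD1, rotated]) (simp add: \<sigma>_def)
    then have perm: "\<sigma> permutes {1..n + q}" by (rule bij_imp_permutes) (auto simp: \<sigma>_def)
    have first: "\<sigma> j = sorted_list_of_set S ! (j - 1)" if "j \<in> {1..n}" for j
      using that S by (auto simp: \<sigma>_def nth_append)
    have second: "\<sigma> j = sorted_list_of_set ?T ! (j - n - 1)" if "j \<in> {n + 1..n + q}" for j
      using that S by (auto simp: \<sigma>_def nth_append)
    have "strict_mono_on {1..n} \<sigma>"
    proof (rule strict_mono_onI)
      fix i j assume "i \<in> {1..n}" "j \<in> {1..n}" "i < j"
      then show "\<sigma> i < \<sigma> j"
        using sorted_wrt_nth_less[OF strict_sorted_list_of_set[of S], of "i - 1" "j - 1"] S first
        by simp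
    qed
    moreover have "strict_mono_on {n + 1..n + q} \<sigma>"
    proof (rule strict_mono_onI)
      fix i j assume "i \<in> {n + 1..n + q}" "j \<in> {n + 1..n + q}" "i < j"
      then show "\<sigma> i < \<sigma> j"
        using sorted_wrt_nth_less[OF strict_sorted_list_of_set[of ?T], of "i - n - 1" "j - n - 1"]
          cT second by simp
    qed
    ultimately have "\<sigma> \<in> Sh n q" using perm by (simp add: Sh_def)
    moreover have "\<sigma> ` {1..n} = S"
    proof -
      have "\<sigma> ` {1..n} = (!) (sorted_list_of_set S) ` ((\<lambda>j. j - 1) ` {1..n})"
        unfolding image_image using first by (intro image_cong) auto
      also have "(\<lambda>j. j - 1) ` {1..n} = {0..<n}"
        by (auto simp: image_iff intro!: bexI[of _ "Suc _"])
      also have "(!) (sorted_list_of_set S) ` {0..<n} = S"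
        using S fin nth_image[of n "sorted_list_of_set S"] by simp
      finally show ?thesis .
    qed
    ultimately show "S \<in> (\<lambda>\<sigma>. \<sigma> ` {1..n}) ` Sh n q" by blast
  qed
qed

lemma downward_closed_eq_atLeastAtMost:
  fixes J :: "nat set"
  assumes "finite J" "0 \<notin> J" "\<And>j k. k \<in> J \<Longrightarrow> 1 \<le> j \<Longrightarrow> j \<le> k \<Longrightarrow> j \<in> J"
  shows "J = {1..card J}"
proof (cases "J = {}")
  case False
  have "J = {1..Max J}"
  proof (intro equalityI subsetI)
    fix j assume "j \<in> J"
    then show "j \<in> {1..Max J}" using assms(1,2) by (cases j) auto
  next
    fix j assume "j \<in> {1..Max J}"
    then show "j \<in> J" using assms(3) Max_in[OF assms(1) False] by auto
  qed
  then show ?thesis by (metis card_atLeastAtMost diff_Suc_1' plus_1_eq_Suc diff_Suc_1)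
qed simp

text \<open>
  All that the product needs to know about a shuffle, expressed by its first block \<open>S\<close>: the positions
  before and after the inserted value together with \<open>Max S\<close> enumerate the complement of \<open>lower S\<close>
  increasingly, and the combined sign loses the crossings of \<open>Max S\<close>, since \<open>i - 1\<close> is their number.
\<close>

lemma shuffle_block:
  assumes \<sigma>: "\<sigma> \<in> Sh n q" and n: "n \<ge> 1"
  defines "S \<equiv> \<sigma> ` {1..n}" and "i \<equiv> shuffle_pos n q \<sigma>"
  shows "map \<sigma> [1..<n + 1] = sorted_list_of_set S"
    and "\<sigma> n = Max S"
    and "map \<sigma> [n + 1..<n + i] @ [\<sigma> n] @ map \<sigma> [n + i..<n + q + 1]
           = sorted_list_of_set ({1..n + q} - lower S)"
    and "(- 1) ^ (i - 1) * sign \<sigma> = (- 1) ^ crossings (lower S) ({1..n + q} - lower S)"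
    and "i \<le> q + 1"
proof -
  note perm = ShD(1)[OF \<sigma>]
  note inj = permutes_inj[OF perm]
  \<comment> \<open>The second block is increasing, so its entries below \<open>\<sigma> n\<close> form an initial segment of length \<open>i - 1\<close>.\<close>
  define J where "J = {j \<in> {1..q}. \<sigma> (n + j) < \<sigma> n}"
  have i: "i = 1 + card J" by (simp add: i_def shuffle_pos_def J_def)
  have "card J \<le> card {1..q}" by (rule card_mono) (auto simp: J_def)
  then show iq: "i \<le> q + 1" using i by simp
  have mono1: "\<sigma> j < \<sigma> k" if "j \<in> {1..n}" "k \<in> {1..n}" "j < k" for j k
    using strict_mono_onD[OF ShD(2)[OF \<sigma>]] that by blast
  have mono2: "\<sigma> j < \<sigma> k" if "j \<in> {n + 1..n + q}" "k \<in> {n + 1..n + q}" "j < k" for j k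
    using strict_mono_onD[OF ShD(3)[OF \<sigma>]] that by blast
  show "map \<sigma> [1..<n + 1] = sorted_list_of_set S"
    unfolding S_def sorted_list_of_set_image_strict_mono[OF finite_atLeastAtMost ShD(2)[OF \<sigma>]]
      sorted_list_of_set_atLeastAtMost_1 ..
  have finS: "finite S" by (simp add: S_def)
  show mx: "\<sigma> n = Max S"
  proof (rule Max_eqI[symmetric, OF finS])
    show "\<sigma> n \<in> S" using n by (simp add: S_def)
    fix y assume "y \<in> S"
    then obtain j where j: "j \<in> {1..n}" "y = \<sigma> j" by (auto simp: S_def)
    then show "y \<le> \<sigma> n" using mono1[of j n] n by (cases "j = n") auto
  qed
  have J_eq: "J = {1..card J}"
  proof (rule downward_closed_eq_atLeastAtMost)
    fix j k assume "k \<in> J" "1 \<le> j" "j \<le> k"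
    then show "j \<in> J" using mono2[of "n + j" "n + k"] by (cases "j = k") (auto simp: J_def)
  qed (auto simp: J_def)
  define c where "c = card J"
  have J: "J = {1..c}" and ic: "i = 1 + c" using J_eq i by (simp_all add: c_def)
  have below: "\<sigma> j < \<sigma> n" if "j \<in> {n + 1..<n + i}" for j
  proof -
    have "j - n \<in> J" unfolding J using that ic by auto
    then show ?thesis using that by (auto simp: J_def)
  qed
  have above: "\<sigma> n < \<sigma> j" if "j \<in> {n + i..<n + q + 1}" for j
  proof -
    have "j - n \<notin> J" unfolding J using that ic by auto
    then have "\<not> \<sigma> j < \<sigma> n" using that i by (auto simp: J_def)
    moreover have "\<sigma> j \<noteq> \<sigma> n" using injD[OF inj, of j n] that i by auto
    ultimately show ?thesis by simp
  qed
  have diff: "{1..n + q} - lower S = \<sigma> ` ({n + 1..n + q} \<union> {n})"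
  proof -
    have "lower S = \<sigma> ` ({1..n} - {n})"
      unfolding lower_def mx[symmetric] using image_set_diff[OF inj, of "{1..n}" "{n}"] by (simp add: S_def)
    moreover have "{1..n + q} - ({1..n} - {n}) = {n + 1..n + q} \<union> {n}" using n by auto
    ultimately show ?thesis
      using image_set_diff[OF inj, of "{1..n + q}" "{1..n} - {n}"] permutes_image[OF perm] by simp
  qed
  show "map \<sigma> [n + 1..<n + i] @ [\<sigma> n] @ map \<sigma> [n + i..<n + q + 1]
           = sorted_list_of_set ({1..n + q} - lower S)"
  proof (rule strict_sorted_equal)
    have "sorted_wrt (\<lambda>x y. \<sigma> x < \<sigma> y) [n + 1..<n + i]"
      by (rule sorted_wrt_mono_rel[of _ "(<)"]) (use mono2 iq in \<open>auto simp del: upt_Suc\<close>)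
    moreover have "sorted_wrt (\<lambda>x y. \<sigma> x < \<sigma> y) [n + i..<n + q + 1]"
      by (rule sorted_wrt_mono_rel[of _ "(<)"]) (use mono2 i in \<open>auto simp del: upt_Suc\<close>)
    ultimately show "sorted_wrt (<) (map \<sigma> [n + 1..<n + i] @ [\<sigma> n] @ map \<sigma> [n + i..<n + q + 1])"
      using below above less_trans[OF below above]
      by (auto simp: sorted_wrt_append sorted_wrt_map simp del: upt_Suc)
    have split: "{n + 1..n + q} = {n + 1..<n + i} \<union> {n + i..<n + q + 1}" using i iq by auto
    have "set (map \<sigma> [n + 1..<n + i] @ [\<sigma> n] @ map \<sigma> [n + i..<n + q + 1]) = {1..n + q} - lower S"
      unfolding diff split by (simp add: image_Un Un_ac del: upt_Suc)
    also have "\<dots> = set (sorted_list_of_set ({1..n + q} - lower S))"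
      by (rule set_sorted_list_of_set[symmetric]) simp
    finally show "set (map \<sigma> [n + 1..<n + i] @ [\<sigma> n] @ map \<sigma> [n + i..<n + q + 1]) =
        set (sorted_list_of_set ({1..n + q} - lower S))" .
  qed simp
  show "(- 1) ^ (i - 1) * sign \<sigma> = (- 1) ^ crossings (lower S) ({1..n + q} - lower S)"
  proof -
    let ?T = "\<sigma> ` {n + 1..n + q}"
    have fins: "finite (lower S)" "finite ?T" using finS by (auto simp: lower_def)
    have maxS: "Max S \<in> S" using finS n by (intro Max_in) (auto simp: S_def)
    then have S: "S = lower S \<union> {Max S}" by (auto simp: lower_def)
    have disj: "\<sigma> n \<notin> ?T"
      using inj_eq[OF inj] by auto
    have "k \<in> {n + 1..n + q} \<and> j \<in> {1..n}"
      if "j \<in> {1..n + q}" "k \<in> {1..n + q}" "j < k" "\<sigma> k < \<sigma> j" for j k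
    proof (rule ccontr)
      assume "\<not> (k \<in> {n + 1..n + q} \<and> j \<in> {1..n})"
      then have "j \<in> {1..n} \<and> k \<in> {1..n} \<or> j \<in> {n + 1..n + q} \<and> k \<in> {n + 1..n + q}"
        using that by auto
      then show False using mono1[of j k] mono2[of j k] that by auto
    qed
    then have "inversions {1..n + q} \<sigma> = {(j, k). j \<in> {1..n} \<and> k \<in> {n + 1..n + q} \<and> \<sigma> k < \<sigma> j}"
      unfolding inversions_def by fastforce
    then have "map_prod \<sigma> \<sigma> ` inversions {1..n + q} \<sigma> = {(x, y) \<in> S \<times> ?T. y < x}"
      by (auto simp: S_def)
    moreover have "card (map_prod \<sigma> \<sigma> ` inversions {1..n + q} \<sigma>) = card (inversions {1..n + q} \<sigma>)"
      using prod.inj_map[OF inj inj] by (intro card_image) (rule inj_on_subset, auto)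
    ultimately have "card (inversions {1..n + q} \<sigma>) = crossings S ?T" by (simp add: crossings_def)
    also have "\<dots> = crossings (lower S) ?T + crossings {Max S} ?T"
      by (subst S, rule crossings_union_left) (use fins in \<open>auto simp: lower_def\<close>)
    also have "crossings {Max S} ?T = card J"
    proof -
      have "{(x, y) \<in> {Max S} \<times> ?T. y < x} = (\<lambda>j. (\<sigma> n, \<sigma> (n + j))) ` J"
      proof -
        have "{n + 1..n + q} = (+) n ` {1..q}" by (simp add: add.commute)
        then have "?T = (\<lambda>j. \<sigma> (n + j)) ` {1..q}" by (simp only: image_image)
        then show ?thesis unfolding mx[symmetric] J_def by auto
      qed
      moreover have "inj_on (\<lambda>j. (\<sigma> n, \<sigma> (n + j))) J"
        by (simp add: inj_on_def inj_eq[OF inj])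
      ultimately show ?thesis by (simp add: crossings_def card_image)
    qed
    also have "crossings (lower S) ?T = crossings (lower S) ({1..n + q} - lower S)"
    proof -
      have "crossings (lower S) {Max S} = 0"
        using finS by (intro crossings_eq_0) (auto simp: lower_def)
      moreover have "crossings (lower S) (?T \<union> {\<sigma> n}) = crossings (lower S) ?T + crossings (lower S) {\<sigma> n}"
        using fins by (intro crossings_union_right) (use disj in auto)
      ultimately show ?thesis unfolding diff mx by (simp add: image_Un mx)
    qed
    finally show ?thesis
      using sign_eq_card_inversions[OF perm] i by (simp add: power_add)
  qed
qed

section \<open>Evaluation on finite sets of positions\<close>

definition eval_on :: "('m list \<Rightarrow> 'm) \<Rightarrow> nat set \<Rightarrow> (nat \<Rightarrow> 'm) \<Rightarrow> 'm" where
  "eval_on f R a = f (map a (sorted_list_of_set R))"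

lemma eval_on_cong: "finite R \<Longrightarrow> (\<And>x. x \<in> R \<Longrightarrow> a x = b x) \<Longrightarrow> eval_on f R a = eval_on f R b"
  by (auto simp: eval_on_def intro!: arg_cong[where f = f])

lemma eval_on_plus: "eval_on (f + f') R a = eval_on f R a + eval_on f' R a"
  by (simp add: eval_on_def)

lemma eval_on_fun_scale: "eval_on (fun_scale scale c f) R a = scale c (eval_on f R a)"
  by (simp add: eval_on_def fun_scale_def)

lemma eval_on_image:
  assumes "finite R" "strict_mono_on R \<phi>"
  shows "eval_on f (\<phi> ` R) a = eval_on f R (a \<circ> \<phi>)"
  using assms by (simp add: eval_on_def sorted_list_of_set_image_strict_mono)

lemma map_nth_from_1: "map (\<lambda>j. as ! (j - 1)) [1..<length as + 1] = as"
  by (rule nth_equalityI) (auto simp del: upt_Suc)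

lemma list_eq_eval_on: "length as = k \<Longrightarrow> f as = eval_on f {1..k} (\<lambda>j. as ! (j - 1))"
  unfolding eval_on_def sorted_list_of_set_atLeastAtMost_1 using map_nth_from_1[of as] by simp

lemma obtain_strict_mono_enumeration:
  assumes "finite (R :: nat set)"
  obtains \<phi> where "strict_mono_on {1..card R} \<phi>" "\<phi> ` {1..card R} = R"
proof
  let ?xs = "sorted_list_of_set R"
  show "strict_mono_on {1..card R} (\<lambda>j. ?xs ! (j - 1))"
  proof (rule strict_mono_onI)
    fix i j assume "i \<in> {1..card R}" "j \<in> {1..card R}" "i < j"
    then show "?xs ! (i - 1) < ?xs ! (j - 1)"
      using sorted_wrt_nth_less[OF strict_sorted_list_of_set[of R], of "i - 1" "j - 1"] by simp
  qed
  have "(\<lambda>j. ?xs ! (j - 1)) ` {1..card R} = set (map (\<lambda>j. ?xs ! (j - 1)) [1..<length ?xs + 1])"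
    by (auto simp del: upt_Suc)
  then show "(\<lambda>j. ?xs ! (j - 1)) ` {1..card R} = R"
    unfolding map_nth_from_1 using assms by simp
qed

lemma Max_image_strict_mono:
  fixes \<phi> :: "nat \<Rightarrow> nat"
  assumes "strict_mono_on R \<phi>" "S \<subseteq> R" "finite S" "S \<noteq> {}"
  shows "Max (\<phi> ` S) = \<phi> (Max S)"
proof (rule Max_eqI)
  fix y assume "y \<in> \<phi> ` S"
  then obtain x where x: "x \<in> S" "y = \<phi> x" by blast
  have "x \<le> Max S" "Max S \<in> S" using x assms by auto
  then show "y \<le> \<phi> (Max S)"
    using x assms(2) strict_mono_onD[OF assms(1), of x "Max S"] by (cases "x < Max S") (auto simp: subset_iff)
qed (use assms in auto)

lemma lower_subset: "lower S \<subseteq> S"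
  by (auto simp: lower_def)

lemma finite_lower [simp]: "finite S \<Longrightarrow> finite (lower S)"
  by (simp add: lower_def)

text \<open>
  A nonempty block \<open>S\<close> of size \<open>n\<close> loses all but one of its positions, so \<open>R - lower S\<close> has as many elements
  as \<open>f\<close> has arguments.
\<close>

lemma block_facts:
  assumes "finite R" "S \<in> subsets_of_card R n" "n \<ge> 1"
  shows "finite S" "S \<noteq> {}" "Max S \<in> S" "S = insert (Max S) (lower S)" "Max S \<notin> lower S"
    "card (lower S) = n - 1" "Max S \<in> R - lower S" "card (R - lower S) = card R + 1 - n"
proof -
  show fin: "finite S" using assms finite_subset by auto
  show ne: "S \<noteq> {}" using assms by auto
  show max: "Max S \<in> S" using fin ne by (rule Max_in)
  then show "S = insert (Max S) (lower S)" by (auto simp: lower_def)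
  show "Max S \<notin> lower S" by (simp add: lower_def)
  show c: "card (lower S) = n - 1" using assms max fin by (simp add: lower_def)
  show "Max S \<in> R - lower S" using assms max by (auto simp: lower_def)
  have "card (R - lower S) = card R - (n - 1)"
    using assms lower_subset[of S] c fin by (subst card_Diff_subset) auto
  then show "card (R - lower S) = card R + 1 - n" using assms by simp
qed

lemma bij_betw_image_subsets_of_card:
  assumes "inj_on \<phi> R"
  shows "bij_betw ((`) \<phi>) (subsets_of_card R n) (subsets_of_card (\<phi> ` R) n)"
proof (rule bij_betw_imageI)
  show "inj_on ((`) \<phi>) (subsets_of_card R n)"
    using inj_on_image_Pow[OF assms] by (rule inj_on_subset) auto
  show "(`) \<phi> ` subsets_of_card R n = subsets_of_card (\<phi> ` R) n"
  proof (intro equalityI subsetI)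
    fix T assume "T \<in> subsets_of_card (\<phi> ` R) n"
    then obtain S where "S \<subseteq> R" "T = \<phi> ` S" "card T = n" by (auto simp: subset_image_iff)
    then show "T \<in> (`) \<phi> ` subsets_of_card R n"
      using card_image[OF inj_on_subset[OF assms]] by auto
  qed (use card_image[OF inj_on_subset[OF assms]] in auto)
qed

lemma lower_image:
  assumes "strict_mono_on R \<phi>" "S \<subseteq> R" "finite S" "S \<noteq> {}"
  shows "lower (\<phi> ` S) = \<phi> ` lower S"
proof -
  have "inj_on \<phi> R" by (rule strict_mono_on_imp_inj_on[OF assms(1)])
  then show ?thesis
    unfolding lower_def Max_image_strict_mono[OF assms]
    using assms(2) Max_in[OF assms(3,4)]
    by (subst inj_on_image_set_diff[of \<phi> R]) auto
qed

section \<open>The product as a sum over subsets\<close>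

locale hom_space = vector_space scale
  for scale :: "'k::field \<Rightarrow> 'm::ab_group_add \<Rightarrow> 'm" (infixr \<open>*s\<close> 75) +
  fixes \<beta> :: "'m \<Rightarrow> 'm"
  assumes linear_beta: "Vector_Spaces.linear scale scale \<beta>"
begin

abbreviation lin :: "('m \<Rightarrow> 'm) \<Rightarrow> bool" where
  "lin \<equiv> Vector_Spaces.linear scale scale"

lemma lin_iff: "lin f \<longleftrightarrow> (\<forall>x y. f (x + y) = f x + f y) \<and> (\<forall>c x. f (c *s x) = c *s f x)"
  by (simp add: linear_iff_module_hom module_hom_iff module_axioms)

lemma lin_compose: "lin f \<Longrightarrow> lin g \<Longrightarrow> lin (\<lambda>x. f (g x))"
  by (simp add: lin_iff)

lemma lin_0: "lin f \<Longrightarrow> f 0 = 0"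
  by (metis lin_iff scale_zero_left)

lemma lin_sum: "lin f \<Longrightarrow> f (\<Sum>i\<in>I. x i) = (\<Sum>i\<in>I. f (x i))"
  by (induction I rule: infinite_finite_induct) (simp_all add: lin_0, simp add: lin_iff)

lemma lin_sum_fun: "(\<And>i. i \<in> I \<Longrightarrow> lin (f i)) \<Longrightarrow> lin (\<lambda>x. \<Sum>i\<in>I. f i x)"
  by (simp add: lin_iff sum.distrib scale_sum_right)

lemma lin_scale_fun: "lin f \<Longrightarrow> lin (\<lambda>x. c *s f x)"
  by (simp add: lin_iff scale_right_distrib mult.commute)

lemma lin_beta_funpow: "lin (\<beta> ^^ k)"
proof (induction k)
  case 0
  show ?case by (simp add: lin_iff)
next
  case (Suc k)
  then show ?case using lin_compose[OF linear_beta Suc] by (simp add: comp_def)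
qed

definition plug :: "nat \<Rightarrow> ('m list \<Rightarrow> 'm) \<Rightarrow> nat set \<Rightarrow> (nat \<Rightarrow> 'm) \<Rightarrow> nat \<Rightarrow> 'm" where
  "plug n g S a = (\<lambda>x. (\<beta> ^^ (n - 1)) (a x))(Max S := eval_on g S a)"

text \<open>
  The product as a function of arguments indexed by a finite set \<open>R\<close>. The arity of \<open>f\<close> is implicit: it is
  \<open>card R + 1 - n\<close>.
\<close>

definition subset_comp :: "nat \<Rightarrow> ('m list \<Rightarrow> 'm) \<Rightarrow> ('m list \<Rightarrow> 'm) \<Rightarrow> nat set \<Rightarrow> (nat \<Rightarrow> 'm) \<Rightarrow> 'm"
  where "subset_comp n f g R a = (\<Sum>S\<in>subsets_of_card R n.
    (- 1) ^ crossings (lower S) (R - lower S) *s eval_on f (R - lower S) (plug n g S a))"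

lemma subset_comp_cong:
  assumes "finite R" "n \<ge> 1" "\<And>x. x \<in> R \<Longrightarrow> a x = b x"
  shows "subset_comp n f g R a = subset_comp n f g R b"
  unfolding subset_comp_def
proof (rule sum.cong[OF refl])
  fix S assume S: "S \<in> subsets_of_card R n"
  note facts = block_facts[OF assms(1) S assms(2)]
  have "eval_on g S a = eval_on g S b" using S assms facts(1) by (intro eval_on_cong) auto
  then have "eval_on f (R - lower S) (plug n g S a) = eval_on f (R - lower S) (plug n g S b)"
    using assms by (intro eval_on_cong) (auto simp: plug_def)
  then show "(- 1) ^ crossings (lower S) (R - lower S) *s eval_on f (R - lower S) (plug n g S a) =
    (- 1) ^ crossings (lower S) (R - lower S) *s eval_on f (R - lower S) (plug n g S b)" by simp
qed

text \<open>
  Everything in the definition depends only on the order of the positions. This is what allows the passage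
  from \<open>{1..N}\<close> to arbitrary finite sets, which arise when one product is evaluated inside another.
\<close>

lemma subset_comp_image:
  assumes R: "finite R" and \<phi>: "strict_mono_on R \<phi>" and n: "n \<ge> 1"
  shows "subset_comp n f g (\<phi> ` R) a = subset_comp n f g R (a \<circ> \<phi>)"
proof -
  note inj = strict_mono_on_imp_inj_on[OF \<phi>]
  show ?thesis
    unfolding subset_comp_def sum.reindex_bij_betw[OF bij_betw_image_subsets_of_card[OF inj], symmetric]
  proof (rule sum.cong[OF refl])
    fix S assume S: "S \<in> subsets_of_card R n"
    note facts = block_facts[OF R S n]
    have sub: "S \<subseteq> R" using S by simp
    have diff: "\<phi> ` R - lower (\<phi> ` S) = \<phi> ` (R - lower S)"
      unfolding lower_image[OF \<phi> sub facts(1,2)]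
      using sub lower_subset[of S] by (subst inj_on_image_set_diff[OF inj]) auto
    have mono: "strict_mono_on (R - lower S) \<phi>" using \<phi> by (rule monotone_on_subset) auto
    have monoS: "strict_mono_on S \<phi>" using \<phi> sub by (rule monotone_on_subset)
    have "eval_on f (\<phi> ` (R - lower S)) (plug n g (\<phi> ` S) a) =
        eval_on f (R - lower S) (plug n g (\<phi> ` S) a \<circ> \<phi>)"
      using R by (intro eval_on_image mono) auto
    also have "\<dots> = eval_on f (R - lower S) (plug n g S (a \<circ> \<phi>))"
    proof (rule eval_on_cong)
      fix x assume x: "x \<in> R - lower S"
      have "\<phi> x = \<phi> (Max S) \<longleftrightarrow> x = Max S" using x facts(7) by (intro inj_on_eq_iff[OF inj]) auto
      then show "(plug n g (\<phi> ` S) a \<circ> \<phi>) x = plug n g S (a \<circ> \<phi>) x"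
        unfolding plug_def Max_image_strict_mono[OF \<phi> sub facts(1,2)] eval_on_image[OF facts(1) monoS]
        by simp
    qed (use R in simp)
    finally have "eval_on f (\<phi> ` (R - lower S)) (plug n g (\<phi> ` S) a) =
      eval_on f (R - lower S) (plug n g S (a \<circ> \<phi>))" .
    moreover have "crossings (lower (\<phi> ` S)) (\<phi> ` (R - lower S)) = crossings (lower S) (R - lower S)"
      unfolding lower_image[OF \<phi> sub facts(1,2)]
      using sub lower_subset[of S] by (intro crossings_image[OF \<phi>]) auto
    ultimately show "(- 1) ^ crossings (lower (\<phi> ` S)) (\<phi> ` R - lower (\<phi> ` S)) *s
        eval_on f (\<phi> ` R - lower (\<phi> ` S)) (plug n g (\<phi> ` S) a) =
      (- 1) ^ crossings (lower S) (R - lower S) *s eval_on f (R - lower S) (plug n g S (a \<circ> \<phi>))"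
      unfolding diff by simp
  qed
qed

lemma eval_on_circ_l_initial:
  assumes m: "m \<ge> 1" and n: "n \<ge> 1"
  shows "eval_on (circ_l scale \<beta> m n f g) {1..m + n - 1} a = subset_comp n f g {1..m + n - 1} a"
proof -
  define q where "q = m - 1"
  have N: "m + n - 1 = n + q" and N': "m + n = n + q + 1" using m by (auto simp: q_def)
  define as where "as = map a (sorted_list_of_set {1..n + q})"
  have len: "length as = n + q" by (simp add: as_def)
  have nth: "as ! (x - 1) = a x" if "x \<in> {1..n + q}" for x
    using that unfolding as_def sorted_list_of_set_atLeastAtMost_1 by (auto simp del: upt_Suc)
  have "eval_on (circ_l scale \<beta> m n f g) {1..m + n - 1} a = circ_l scale \<beta> m n f g as"
    unfolding eval_on_def as_def N ..
  also have "\<dots> = (\<Sum>\<sigma>\<in>Sh n q. (- 1) ^ crossings (lower (\<sigma> ` {1..n})) ({1..n + q} - lower (\<sigma> ` {1..n})) *s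
      eval_on f ({1..n + q} - lower (\<sigma> ` {1..n})) (plug n g (\<sigma> ` {1..n}) a))"
    unfolding circ_l_def len N if_P[OF refl] unfolding N' q_def[symmetric] Let_def
  proof (rule sum.cong[OF refl])
    fix \<sigma> assume \<sigma>: "\<sigma> \<in> Sh n q"
    define S where "S = \<sigma> ` {1..n}"
    define i where "i = shuffle_pos n q \<sigma>"
    note facts = shuffle_block[OF \<sigma> n, folded S_def i_def]
    have i1: "i \<ge> 1" by (simp add: i_def shuffle_pos_def)
    have inj: "\<sigma> x = \<sigma> y \<longleftrightarrow> x = y" for x y using permutes_inj[OF ShD(1)[OF \<sigma>]] by (simp add: inj_eq)
    have at: "as ! (\<sigma> j - 1) = a (\<sigma> j)" if "j \<in> {1..n + q}" for j
      using that permutes_in_image[OF ShD(1)[OF \<sigma>], of j] by (intro nth) blast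
    have block: "g (map (\<lambda>j. as ! (\<sigma> j - 1)) [1..<n + 1]) = eval_on g S a"
      unfolding eval_on_def facts(1)[symmetric] using at by (auto intro!: arg_cong[where f = g] simp del: upt_Suc)
    have "map (\<lambda>j. (\<beta> ^^ (n - 1)) (as ! (\<sigma> j - 1))) [n + 1..<n + i]
        @ [g (map (\<lambda>j. as ! (\<sigma> j - 1)) [1..<n + 1])]
        @ map (\<lambda>j. (\<beta> ^^ (n - 1)) (as ! (\<sigma> j - 1))) [n + i..<n + q + 1]
        = map (plug n g S a) (sorted_list_of_set ({1..n + q} - lower S))"
      unfolding facts(3)[symmetric] block using at facts(2)[symmetric] facts(5) n i1
      by (auto simp: plug_def inj simp del: upt_Suc)
    moreover have "(- 1) ^ (i - 1) * of_int (sign \<sigma>) = ((- 1) ^ crossings (lower S) ({1..n + q} - lower S) :: 'k)"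
      using arg_cong[OF facts(4), of of_int] by simp
    ultimately show "((- 1) ^ (shuffle_pos n q \<sigma> - 1) * of_int (sign \<sigma>)) *s
        f (map (\<lambda>j. (\<beta> ^^ (n - 1)) (as ! (\<sigma> j - 1))) [n + 1..<n + shuffle_pos n q \<sigma>]
        @ [g (map (\<lambda>j. as ! (\<sigma> j - 1)) [1..<n + 1])]
        @ map (\<lambda>j. (\<beta> ^^ (n - 1)) (as ! (\<sigma> j - 1))) [n + shuffle_pos n q \<sigma>..<n + q + 1])
      = (- 1) ^ crossings (lower (\<sigma> ` {1..n})) ({1..n + q} - lower (\<sigma> ` {1..n})) *s
      eval_on f ({1..n + q} - lower (\<sigma> ` {1..n})) (plug n g (\<sigma> ` {1..n}) a)"
      unfolding S_def[symmetric] i_def[symmetric] by (simp only: eval_on_def)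
  qed
  also have "\<dots> = subset_comp n f g {1..n + q} a"
    unfolding subset_comp_def
    by (rule sum.reindex_bij_betw[OF bij_betw_Sh_subsets[of n q]])
  finally show ?thesis by (simp only: N)
qed

lemma eval_on_circ_l:
  assumes "finite R" "card R = m + n - 1" "m \<ge> 1" "n \<ge> 1"
  shows "eval_on (circ_l scale \<beta> m n f g) R a = subset_comp n f g R a"
proof -
  obtain \<phi> where \<phi>: "strict_mono_on {1..m + n - 1} \<phi>" "\<phi> ` {1..m + n - 1} = R"
    using obtain_strict_mono_enumeration[OF assms(1)] assms(2) by metis
  have "eval_on (circ_l scale \<beta> m n f g) R a = eval_on (circ_l scale \<beta> m n f g) {1..m + n - 1} (a \<circ> \<phi>)"
    using eval_on_image[OF _ \<phi>(1)] \<phi>(2) by simp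
  also have "\<dots> = subset_comp n f g R a"
    using subset_comp_image[OF _ \<phi>(1) assms(4)] \<phi>(2) eval_on_circ_l_initial[OF assms(3,4)] by simp
  finally show ?thesis .
qed

end

section \<open>Nested and disjoint blocks\<close>

text \<open>
  Here \<open>h\<close> is inserted at \<open>S\<close> first, and its value, now sitting at \<open>Max S\<close>, is used up by the block \<open>U\<close> of
  \<open>g\<close>. Merging the two blocks into \<open>U \<union> S\<close> loses nothing, and the crossing numbers agree on the nose: both
  sides count the crossings of \<open>lower S\<close> with \<open>lower U\<close> and of each of them with the remaining positions,
  and \<open>Max U\<close>, being an upper bound of \<open>S\<close>, is crossed by no element of \<open>lower S\<close>.
\<close>

lemma nested_blocks:
  assumes R: "finite R" and S: "S \<in> subsets_of_card R p" and p: "p \<ge> 1"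
    and U: "U \<in> subsets_of_card (R - lower S) n" and n: "n \<ge> 1" and nest: "Max S \<in> U"
  shows "U \<union> S \<in> subsets_of_card R (n + p - 1)"
    and "U \<union> S - lower S = U"
    and "Max (U \<union> S) = Max U"
    and "R - lower (U \<union> S) = R - lower S - lower U"
    and "crossings (lower S) (R - lower S) + crossings (lower U) (R - lower S - lower U)
       = crossings (lower (U \<union> S)) (R - lower (U \<union> S)) + crossings (lower S) U"
proof -
  note S' = block_facts[OF R S p]
  note U' = block_facts[OF finite_Diff[OF R] U n]
  let ?W = "R - lower S - lower U"
  have disj: "U \<inter> lower S = {}" using U by auto
  have V: "U \<union> S = U \<union> lower S" using nest by (auto simp: lower_def)
  have "card (U \<union> lower S) = n + p - 1"
    using U S'(1,6) U'(1) disj p by (subst card_Un_disjoint) auto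
  then show "U \<union> S \<in> subsets_of_card R (n + p - 1)" using S U V by auto
  show diff: "U \<union> S - lower S = U" unfolding V using disj by auto
  have le: "x \<le> Max U" if "x \<in> S" for x
    using Max_ge[OF S'(1) that] Max_ge[OF U'(1) nest] by (rule order_trans)
  have leU: "x \<le> Max U" if "x \<in> U" for x
    using Max_ge[OF U'(1) that] .
  show Max: "Max (U \<union> S) = Max U"
    using S'(1) U'(1,3) le leU by (intro Max_eqI) auto
  have lower: "lower (U \<union> S) = lower U \<union> lower S"
    unfolding lower_def[of "U \<union> S"] Max unfolding V using U'(3) disj by (auto simp: lower_def[of U])
  show diff': "R - lower (U \<union> S) = ?W" unfolding lower by auto
  have lU: "lower U \<subseteq> R - lower S" "lower U \<subseteq> U" using U lower_subset[of U] by auto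
  have "crossings (lower S) (R - lower S) = crossings (lower S) (lower U \<union> ?W)"
    using lU by (intro arg_cong2[where f = crossings]) auto
  also have "\<dots> = crossings (lower S) (lower U) + crossings (lower S) ?W"
    using R S'(1) U'(1) by (intro crossings_union_right) auto
  finally have 1: "crossings (lower S) (R - lower S) = crossings (lower S) (lower U) + crossings (lower S) ?W" .
  have 2: "crossings (lower U \<union> lower S) ?W = crossings (lower U) ?W + crossings (lower S) ?W"
    using R S'(1) U'(1) lU disj by (intro crossings_union_left) auto
  have "crossings (lower S) U = crossings (lower S) (lower U \<union> {Max U})"
    using U'(4) by (intro arg_cong2[where f = crossings]) auto
  also have "\<dots> = crossings (lower S) (lower U) + crossings (lower S) {Max U}"
    using S'(1) U'(1,5) by (intro crossings_union_right) auto
  also have "crossings (lower S) {Max U} = 0"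
    using le lower_subset[of S] by (intro crossings_eq_0) auto
  finally show "crossings (lower S) (R - lower S) + crossings (lower U) ?W
       = crossings (lower (U \<union> S)) (R - lower (U \<union> S)) + crossings (lower S) U"
    using 1 2 unfolding lower diff'[unfolded lower] by simp
qed

lemma nested_blocks_converse:
  assumes R: "finite R" and V: "V \<in> subsets_of_card R (n + p - 1)"
    and S: "S \<in> subsets_of_card V p" and p: "p \<ge> 1" and n: "n \<ge> 1"
  shows "S \<in> subsets_of_card R p" "V - lower S \<in> subsets_of_card (R - lower S) n"
    "Max S \<in> V - lower S" "V - lower S \<union> S = V"
proof -
  have finV: "finite V" using R V finite_subset by auto
  note S' = block_facts[OF finV S p]
  show "S \<in> subsets_of_card R p" using S V by auto
  have "card (V - lower S) = n" using S'(8) V p by auto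
  then show "V - lower S \<in> subsets_of_card (R - lower S) n" using V by auto
  show "Max S \<in> V - lower S" by (rule S'(7))
  show "V - lower S \<union> S = V" using S lower_subset[of S] by auto
qed

lemma crossings_disjoint_blocks:
  assumes R: "finite R" and S: "S \<subseteq> R" and U: "U \<subseteq> R" and disj: "S \<inter> U = {}"
  shows "crossings (lower S) (R - lower S) =
    crossings (lower S) (lower U) + crossings (lower S) (R - lower S - lower U)"
proof -
  have fin: "finite S" "finite U" using R S U finite_subset by auto
  have "R - lower S = lower U \<union> (R - lower S - lower U)"
    using U disj lower_subset[of S] lower_subset[of U] by auto
  then have "crossings (lower S) (R - lower S) = crossings (lower S) (lower U \<union> (R - lower S - lower U))"
    by simp
  also have "\<dots> = crossings (lower S) (lower U) + crossings (lower S) (R - lower S - lower U)"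
    using fin R by (intro crossings_union_right) auto
  finally show ?thesis .
qed

context hom_space
begin

section \<open>Cochains are closed under the product\<close>

lemma multilinear_eval_on:
  assumes "multilinear_on_lists scale k f" "finite R" "card R = k" "r \<in> R"
  shows "lin (\<lambda>x. eval_on f R (a(r := x)))"
proof -
  let ?xs = "sorted_list_of_set R"
  obtain i where i: "i < length ?xs" "?xs ! i = r"
    using assms(2,4) by (metis in_set_conv_nth set_sorted_list_of_set)
  have "map (a(r := x)) ?xs = (map a ?xs)[i := x]" for x
  proof (rule nth_equalityI)
    fix j assume j: "j < length (map (a(r := x)) ?xs)"
    have "?xs ! j = r \<longleftrightarrow> j = i"
      using i j nth_eq_iff_index_eq[OF distinct_sorted_list_of_set[of R], of j i] by auto
    then show "map (a(r := x)) ?xs ! j = (map a ?xs)[i := x] ! j"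
      using i j by (auto simp: nth_list_update)
  qed simp
  then show ?thesis
    using assms i unfolding multilinear_on_lists_def eval_on_def by simp
qed

lemma multilinearI:
  assumes "\<And>a r. r \<in> {1..k} \<Longrightarrow> lin (\<lambda>x. eval_on f {1..k} (a(r := x)))"
  shows "multilinear_on_lists scale k f"
  unfolding multilinear_on_lists_def
proof (intro allI impI)
  fix as :: "'m list" and i assume len: "length as = k" and i: "i < k"
  have "f (as[i := x]) = eval_on f {1..k} ((\<lambda>j. as ! (j - 1))(Suc i := x))" for x
  proof -
    have "f (as[i := x]) = eval_on f {1..k} (\<lambda>j. as[i := x] ! (j - 1))"
      using len by (intro list_eq_eval_on) simp
    also have "\<dots> = eval_on f {1..k} ((\<lambda>j. as ! (j - 1))(Suc i := x))"
      using len i by (intro eval_on_cong) (auto simp: nth_list_update)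
    finally show ?thesis .
  qed
  then show "lin (\<lambda>x. f (as[i := x]))" using assms[of "Suc i"] i by simp
qed

abbreviation cochain :: "nat \<Rightarrow> ('m list \<Rightarrow> 'm) set" where
  "cochain k \<equiv> cochains scale \<beta> k"

lemma cochain_multilinear: "f \<in> cochain k \<Longrightarrow> multilinear_on_lists scale k f"
  by (simp add: cochains_def)

lemma cochain_eval_on_eq_0: "f \<in> cochain k \<Longrightarrow> card R \<noteq> k \<Longrightarrow> eval_on f R a = 0"
  by (simp add: cochains_def eval_on_def)

lemma cochain_funpow:
  assumes "f \<in> cochain k" "card R = k"
  shows "(\<beta> ^^ j) (eval_on f R a) = eval_on f R (\<lambda>x. (\<beta> ^^ j) (a x))"
proof (induction j)
  case (Suc j)
  have "(\<beta> ^^ Suc j) (eval_on f R a) = \<beta> (eval_on f R (\<lambda>x. (\<beta> ^^ j) (a x)))"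
    using Suc by simp
  also have "\<dots> = eval_on f R (\<lambda>x. \<beta> ((\<beta> ^^ j) (a x)))"
    using assms by (simp add: cochains_def eval_on_def comp_def)
  finally show ?case by simp
qed simp

text \<open>
  Linearity of \<open>f\<close> in the slot that receives the value of the inner cochain; used wherever a sum, a scalar or
  a zero has to be pulled out of that slot.
\<close>

lemma lin_eval_on_plug_slot:
  assumes f: "multilinear_on_lists scale (card R + 1 - n) f" and R: "finite R" and n: "n \<ge> 1"
    and S: "S \<in> subsets_of_card R n"
  shows "lin (\<lambda>v. eval_on f (R - lower S) (b(Max S := v)))"
  using block_facts[OF R S n] R by (intro multilinear_eval_on[OF f]) auto

text \<open>
  Each summand is linear in the argument at \<open>r\<close>: if \<open>r\<close> belongs to the block, it enters only through the
  value of \<open>g\<close>, and otherwise only through its own slot of \<open>f\<close>, twisted by a power of \<open>\<beta>\<close>.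
\<close>

lemma subset_comp_multilinear:
  assumes f: "multilinear_on_lists scale m f" and g: "multilinear_on_lists scale n g"
    and n: "n \<ge> 1" and R: "finite R" "card R = m + n - 1" and r: "r \<in> R"
  shows "lin (\<lambda>x. subset_comp n f g R (a(r := x)))"
  unfolding subset_comp_def
proof (intro lin_sum_fun lin_scale_fun)
  fix S assume S: "S \<in> subsets_of_card R n"
  note facts = block_facts[OF R(1) S n]
  have f': "multilinear_on_lists scale (card R + 1 - n) f" using f R n by simp
  let ?b = "\<lambda>x. (\<beta> ^^ (n - 1)) (a x)"
  show "lin (\<lambda>x. eval_on f (R - lower S) (plug n g S (a(r := x))))"
  proof (cases "r \<in> S")
    case True
    have "eval_on f (R - lower S) (plug n g S (a(r := x)))
        = eval_on f (R - lower S) (?b(Max S := eval_on g S (a(r := x))))" for x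
      using True R(1) by (intro eval_on_cong) (auto simp: plug_def lower_def)
    moreover have "lin (\<lambda>x. eval_on g S (a(r := x)))"
      using True S facts(1) by (intro multilinear_eval_on[OF g]) auto
    ultimately show ?thesis using lin_compose[OF lin_eval_on_plug_slot[OF f' R(1) n S]] by simp
  next
    case False
    then have ne: "Max S \<noteq> r" using facts(3) by blast
    have eq: "eval_on g S (a(r := x)) = eval_on g S a" for x
      using False facts(1) by (intro eval_on_cong) auto
    have "plug n g S (a(r := x)) = (plug n g S a)(r := (\<beta> ^^ (n - 1)) x)" for x
      unfolding plug_def eq using ne by auto
    moreover have "lin (\<lambda>x. eval_on f (R - lower S) ((plug n g S a)(r := x)))"
      using False r R n facts(8) lower_subset[of S] by (intro multilinear_eval_on[OF f]) auto
    ultimately show ?thesis using lin_compose[OF _ lin_beta_funpow[of "n - 1"]] by simp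
  qed
qed

lemma subset_comp_beta:
  assumes f: "f \<in> cochain m" and g: "g \<in> cochain n"
    and n: "n \<ge> 1" and R: "finite R" "card R = m + n - 1"
  shows "\<beta> (subset_comp n f g R a) = subset_comp n f g R (\<lambda>x. \<beta> (a x))"
  unfolding subset_comp_def lin_sum[OF linear_beta]
proof (rule sum.cong[OF refl])
  fix S assume S: "S \<in> subsets_of_card R n"
  note facts = block_facts[OF R(1) S n]
  have "\<beta> (eval_on f (R - lower S) (plug n g S a)) = eval_on f (R - lower S) (\<lambda>x. \<beta> (plug n g S a x))"
    using cochain_funpow[OF f, of "R - lower S" 1] facts(8) R(2) n by simp
  also have "(\<lambda>x. \<beta> (plug n g S a x)) = plug n g S (\<lambda>x. \<beta> (a x))"
    using cochain_funpow[OF g, of S 1] S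
    by (auto simp: plug_def funpow_swap1)
  finally show "\<beta> ((- 1) ^ crossings (lower S) (R - lower S) *s eval_on f (R - lower S) (plug n g S a)) =
    (- 1) ^ crossings (lower S) (R - lower S) *s eval_on f (R - lower S) (plug n g S (\<lambda>x. \<beta> (a x)))"
    using linear_beta by (simp add: lin_iff)
qed

lemma circ_l_eq_subset_comp:
  assumes "length as = m + n - 1" "m \<ge> 1" "n \<ge> 1"
  shows "circ_l scale \<beta> m n f g as = subset_comp n f g {1..m + n - 1} (\<lambda>j. as ! (j - 1))"
  by (simp only: list_eq_eval_on[OF assms(1), of "circ_l scale \<beta> m n f g"]
      eval_on_circ_l_initial[OF assms(2,3)])

lemma circ_l_cochain:
  assumes f: "f \<in> cochain m" and g: "g \<in> cochain n" and m: "m \<ge> 1" and n: "n \<ge> 1"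
  shows "circ_l scale \<beta> m n f g \<in> cochain (m + n - 1)"
  unfolding cochains_def
proof (intro CollectI conjI allI impI)
  let ?c = "circ_l scale \<beta> m n f g" and ?R = "{1..m + n - 1}"
  show "?c as = 0" if "length as \<noteq> m + n - 1" for as
    using that by (simp add: circ_l_def)
  show "multilinear_on_lists scale (m + n - 1) ?c"
  proof (rule multilinearI)
    fix a r assume "r \<in> ?R"
    then show "lin (\<lambda>x. eval_on ?c ?R (a(r := x)))"
      unfolding eval_on_circ_l_initial[OF m n]
      by (intro subset_comp_multilinear[OF cochain_multilinear[OF f] cochain_multilinear[OF g] n]) auto
  qed
  show "\<beta> (?c as) = ?c (map \<beta> as)" if len: "length as = m + n - 1" for as
  proof -
    have "subset_comp n f g ?R (\<lambda>j. map \<beta> as ! (j - 1)) = subset_comp n f g ?R (\<lambda>j. \<beta> (as ! (j - 1)))"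
      using len by (intro subset_comp_cong[OF _ n]) auto
    then show ?thesis
      using circ_l_eq_subset_comp[OF _ m n] subset_comp_beta[OF f g n] len by simp
  qed
qed

section \<open>The associator\<close>

text \<open>
  \<open>h\<close> and \<open>g\<close> are inserted into \<open>f\<close> at disjoint blocks \<open>S\<close> and \<open>U\<close>. The arguments of each inner cochain carry
  the twist coming from the other one, and the remaining arguments carry both.
\<close>

definition parallel_comp ::
  "('m list \<Rightarrow> 'm) \<Rightarrow> nat \<Rightarrow> ('m list \<Rightarrow> 'm) \<Rightarrow> nat \<Rightarrow> ('m list \<Rightarrow> 'm) \<Rightarrow> nat set \<Rightarrow> (nat \<Rightarrow> 'm) \<Rightarrow> 'm"
  where "parallel_comp f n g p h R a =
    (\<Sum>(S, U) \<in> {(S, U). S \<in> subsets_of_card R p \<and> U \<in> subsets_of_card R n \<and> S \<inter> U = {}}.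
      (- 1) ^ (crossings (lower S) (R - lower S) + crossings (lower U) (R - lower S - lower U)) *s
      eval_on f (R - lower S - lower U)
        ((\<lambda>x. (\<beta> ^^ (n - 1 + (p - 1))) (a x))
          (Max S := eval_on h S (\<lambda>x. (\<beta> ^^ (n - 1)) (a x)),
           Max U := eval_on g U (\<lambda>x. (\<beta> ^^ (p - 1)) (a x)))))"

text \<open>
  Apart from the crossings between \<open>lower S\<close> and \<open>lower U\<close>, the summand is symmetric in the two insertions.
  The two orders see complementary sets of such crossings, \<open>(n - 1)(p - 1)\<close> in total.
\<close>

lemma parallel_comp_swap:
  assumes R: "finite R" and n: "n \<ge> 1" and p: "p \<ge> 1"
  shows "parallel_comp f n g p h R a = (- 1) ^ ((n - 1) * (p - 1)) *s parallel_comp f p h n g R a"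
  unfolding parallel_comp_def scale_sum_right
proof (rule sum.reindex_bij_witness[of _ prod.swap prod.swap])
  fix x assume "x \<in> {(S, U). S \<in> subsets_of_card R p \<and> U \<in> subsets_of_card R n \<and> S \<inter> U = {}}"
  then obtain S U where x: "x = (S, U)" and S: "S \<in> subsets_of_card R p"
    and U: "U \<in> subsets_of_card R n" and disj: "S \<inter> U = {}" by blast
  note S' = block_facts[OF R S p] and U' = block_facts[OF R U n]
  have W: "R - lower U - lower S = R - lower S - lower U" by auto
  have "lower S \<inter> lower U = {}" using disj lower_subset[of S] lower_subset[of U] by blast
  then have total: "crossings (lower S) (lower U) + crossings (lower U) (lower S) = (p - 1) * (n - 1)"
    using crossings_swap[of "lower S" "lower U"] S'(1,6) U'(1,6) by simp
  have Sc: "crossings (lower S) (R - lower S) =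
      crossings (lower S) (lower U) + crossings (lower S) (R - lower S - lower U)"
    using crossings_disjoint_blocks[OF R _ _ disj] S U by simp
  have Uc: "crossings (lower U) (R - lower U) =
      crossings (lower U) (lower S) + crossings (lower U) (R - lower S - lower U)"
    using crossings_disjoint_blocks[OF R, of U S] S U disj W by (simp add: Int_commute)
  have "(- 1 :: 'k) ^ ((n - 1) * (p - 1)) *
      (- 1) ^ (crossings (lower U) (R - lower U) + crossings (lower S) (R - lower U - lower S)) =
    (- 1) ^ (crossings (lower S) (R - lower S) + crossings (lower U) (R - lower S - lower U)) *
      ((- 1) ^ crossings (lower U) (lower S) * (- 1) ^ crossings (lower U) (lower S))"
    unfolding mult.commute[of "n - 1"] total[symmetric] Sc Uc W by (simp add: power_add)
  then have sign: "(- 1 :: 'k) ^ ((n - 1) * (p - 1)) *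
      (- 1) ^ (crossings (lower U) (R - lower U) + crossings (lower S) (R - lower U - lower S)) =
    (- 1) ^ (crossings (lower S) (R - lower S) + crossings (lower U) (R - lower S - lower U))"
    by (simp flip: power_mult_distrib)
  have "Max S \<noteq> Max U" using S'(3) U'(3) disj by auto
  then show "(- 1) ^ ((n - 1) * (p - 1)) *s (case prod.swap x of (S, U) \<Rightarrow>
      (- 1) ^ (crossings (lower S) (R - lower S) + crossings (lower U) (R - lower S - lower U)) *s
      eval_on f (R - lower S - lower U)
        ((\<lambda>x. (\<beta> ^^ (p - 1 + (n - 1))) (a x))
          (Max S := eval_on g S (\<lambda>x. (\<beta> ^^ (p - 1)) (a x)),
           Max U := eval_on h U (\<lambda>x. (\<beta> ^^ (n - 1)) (a x))))) =
    (case x of (S, U) \<Rightarrow>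
      (- 1) ^ (crossings (lower S) (R - lower S) + crossings (lower U) (R - lower S - lower U)) *s
      eval_on f (R - lower S - lower U)
        ((\<lambda>x. (\<beta> ^^ (n - 1 + (p - 1))) (a x))
          (Max S := eval_on h S (\<lambda>x. (\<beta> ^^ (n - 1)) (a x)),
           Max U := eval_on g U (\<lambda>x. (\<beta> ^^ (p - 1)) (a x)))))"
    unfolding x prod.swap_def fst_conv snd_conv prod.case scale_scale sign add.commute[of "p - 1"]
    unfolding W by (simp only: fun_upd_twist not_False_eq_True)
qed auto

lemma iterated_comp_left:
  assumes R: "finite R" "card R = m + n + p - 2" and m: "m \<ge> 1" and n: "n \<ge> 1" and p: "p \<ge> 1"
  shows "subset_comp p (circ_l scale \<beta> m n f g) h R a =
    (\<Sum>(S, U) \<in> Sigma (subsets_of_card R p) (\<lambda>S. subsets_of_card (R - lower S) n).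
      (- 1) ^ (crossings (lower S) (R - lower S) + crossings (lower U) (R - lower S - lower U)) *s
      eval_on f (R - lower S - lower U) (plug n g U (plug p h S a)))"
proof -
  have "subset_comp p (circ_l scale \<beta> m n f g) h R a =
    (\<Sum>S \<in> subsets_of_card R p. \<Sum>U \<in> subsets_of_card (R - lower S) n.
      (- 1) ^ (crossings (lower S) (R - lower S) + crossings (lower U) (R - lower S - lower U)) *s
      eval_on f (R - lower S - lower U) (plug n g U (plug p h S a)))"
    unfolding subset_comp_def[of p]
  proof (rule sum.cong[OF refl])
    fix S assume S: "S \<in> subsets_of_card R p"
    have "card (R - lower S) = m + n - 1"
      using block_facts(8)[OF R(1) S p] R(2) m n p by simp
    then show "(- 1) ^ crossings (lower S) (R - lower S) *s
        eval_on (circ_l scale \<beta> m n f g) (R - lower S) (plug p h S a) =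
      (\<Sum>U \<in> subsets_of_card (R - lower S) n.
        (- 1) ^ (crossings (lower S) (R - lower S) + crossings (lower U) (R - lower S - lower U)) *s
        eval_on f (R - lower S - lower U) (plug n g U (plug p h S a)))"
      using R(1) m n by (simp add: eval_on_circ_l subset_comp_def scale_sum_right power_add)
  qed
  also have "\<dots> = (\<Sum>(S, U) \<in> Sigma (subsets_of_card R p) (\<lambda>S. subsets_of_card (R - lower S) n).
      (- 1) ^ (crossings (lower S) (R - lower S) + crossings (lower U) (R - lower S - lower U)) *s
      eval_on f (R - lower S - lower U) (plug n g U (plug p h S a)))"
    using R(1) by (intro sum.Sigma) auto
  finally show ?thesis .
qed

lemma iterated_comp_right:
  assumes f: "multilinear_on_lists scale m f"
    and R: "finite R" "card R = m + n + p - 2" and m: "m \<ge> 1" and n: "n \<ge> 1" and p: "p \<ge> 1"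
  shows "subset_comp (n + p - 1) f (circ_l scale \<beta> n p g h) R a =
    (\<Sum>(V, S) \<in> Sigma (subsets_of_card R (n + p - 1)) (\<lambda>V. subsets_of_card V p).
      (- 1) ^ (crossings (lower V) (R - lower V) + crossings (lower S) (V - lower S)) *s
      eval_on f (R - lower V) ((\<lambda>x. (\<beta> ^^ (n + p - 2)) (a x))
        (Max V := eval_on g (V - lower S) (plug p h S a))))"
proof -
  have "subset_comp (n + p - 1) f (circ_l scale \<beta> n p g h) R a =
    (\<Sum>V \<in> subsets_of_card R (n + p - 1). \<Sum>S \<in> subsets_of_card V p.
      (- 1) ^ (crossings (lower V) (R - lower V) + crossings (lower S) (V - lower S)) *s
      eval_on f (R - lower V) ((\<lambda>x. (\<beta> ^^ (n + p - 2)) (a x))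
        (Max V := eval_on g (V - lower S) (plug p h S a))))"
    unfolding subset_comp_def[of "n + p - 1"]
  proof (rule sum.cong[OF refl])
    fix V assume V: "V \<in> subsets_of_card R (n + p - 1)"
    have np: "n + p - 1 \<ge> 1" and card: "card R + 1 - (n + p - 1) = m" and e: "n + p - 1 - 1 = n + p - 2"
      using R(2) n p m by auto
    have finV: "finite V" using R V finite_subset by auto
    \<comment> \<open>The inner sum is pulled out of the slot of \<open>f\<close> at \<open>Max V\<close>.\<close>
    let ?L = "\<lambda>v. eval_on f (R - lower V) ((\<lambda>x. (\<beta> ^^ (n + p - 2)) (a x))(Max V := v))"
    have L: "lin ?L" using f card by (intro lin_eval_on_plug_slot[OF _ R(1) np V]) simp
    have "eval_on f (R - lower V) (plug (n + p - 1) (circ_l scale \<beta> n p g h) V a) =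
        ?L (subset_comp p g h V a)"
      unfolding plug_def e using V finV n p by (subst eval_on_circ_l) auto
    also have "\<dots> = (\<Sum>S\<in>subsets_of_card V p.
        (- 1) ^ crossings (lower S) (V - lower S) *s ?L (eval_on g (V - lower S) (plug p h S a)))"
      unfolding subset_comp_def lin_sum[OF L] using L by (simp add: lin_iff)
    finally show "(- 1) ^ crossings (lower V) (R - lower V) *s
        eval_on f (R - lower V) (plug (n + p - 1) (circ_l scale \<beta> n p g h) V a) =
      (\<Sum>S \<in> subsets_of_card V p.
        (- 1) ^ (crossings (lower V) (R - lower V) + crossings (lower S) (V - lower S)) *s
        ?L (eval_on g (V - lower S) (plug p h S a)))"
      by (simp add: scale_sum_right power_add)
  qed
  also have "\<dots> = (\<Sum>(V, S) \<in> Sigma (subsets_of_card R (n + p - 1)) (\<lambda>V. subsets_of_card V p).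
      (- 1) ^ (crossings (lower V) (R - lower V) + crossings (lower S) (V - lower S)) *s
      eval_on f (R - lower V) ((\<lambda>x. (\<beta> ^^ (n + p - 2)) (a x))
        (Max V := eval_on g (V - lower S) (plug p h S a))))"
    using R(1) finite_subset[OF _ R(1)] by (intro sum.Sigma) auto
  finally show ?thesis .
qed

text \<open>
  In the expansion of \<open>(f \<circ> g) \<circ> h\<close>, the pairs \<open>(S, U)\<close> are split according to whether the value of \<open>h\<close>,
  located at \<open>Max S\<close>, is fed into \<open>g\<close>. Compatibility of \<open>h\<close> with \<open>\<beta>\<close> enters only when it is not: then
  \<open>\<beta>\<^sup>n\<^sup>-\<^sup>1\<close> is applied to the value of \<open>h\<close> and has to be moved to its arguments.
\<close>

lemma associator_eq_parallel_comp:
  assumes f: "multilinear_on_lists scale m f" and h: "h \<in> cochain p"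
    and R: "finite R" "card R = m + n + p - 2" and m: "m \<ge> 1" and n: "n \<ge> 1" and p: "p \<ge> 1"
  shows "subset_comp p (circ_l scale \<beta> m n f g) h R a =
    subset_comp (n + p - 1) f (circ_l scale \<beta> n p g h) R a + parallel_comp f n g p h R a"
proof -
  define A where "A = Sigma (subsets_of_card R p) (\<lambda>S. subsets_of_card (R - lower S) n)"
  define T where "T = (\<lambda>(S, U).
      (- 1) ^ (crossings (lower S) (R - lower S) + crossings (lower U) (R - lower S - lower U)) *s
      eval_on f (R - lower S - lower U) (plug n g U (plug p h S a)))"
  have "A \<subseteq> Pow R \<times> Pow R" by (auto simp: A_def)
  then have finA: "finite A" by (rule finite_subset) (use R(1) in simp)
  \<comment> \<open>The inverse bijections \<open>(V, S) \<mapsto> (S, V - lower S)\<close> and \<open>(S, U) \<mapsto> (U \<union> S, S)\<close> match the summands.\<close>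
  have nested: "sum T {(S, U) \<in> A. Max S \<in> U} = subset_comp (n + p - 1) f (circ_l scale \<beta> n p g h) R a"
    unfolding iterated_comp_right[OF f R m n p]
  proof (rule sum.reindex_bij_witness[of _ "\<lambda>(V, S). (S, V - lower S)" "\<lambda>(S, U). (U \<union> S, S)"])
    fix x assume "x \<in> {(S, U) \<in> A. Max S \<in> U}"
    then obtain S U where x: "x = (S, U)" and S: "S \<in> subsets_of_card R p"
      and U: "U \<in> subsets_of_card (R - lower S) n" and nest: "Max S \<in> U" by (auto simp: A_def)
    note facts = nested_blocks[OF R(1) S p U n nest]
    note U' = block_facts[OF finite_Diff[OF R(1)] U n]
    show "(case case x of (S, U) \<Rightarrow> (U \<union> S, S) of (V, S) \<Rightarrow> (S, V - lower S)) = x"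
      unfolding x using facts(2) by simp
    show "(case x of (S, U) \<Rightarrow> (U \<union> S, S)) \<in>
        Sigma (subsets_of_card R (n + p - 1)) (\<lambda>V. subsets_of_card V p)"
      unfolding x using facts(1) S by simp
    have e: "n + p - 2 = n - 1 + (p - 1)" using n p by simp
    have "eval_on f (R - lower S - lower U) (plug n g U (plug p h S a)) =
      eval_on f (R - lower S - lower U)
        ((\<lambda>x. (\<beta> ^^ (n + p - 2)) (a x))(Max U := eval_on g U (plug p h S a)))"
    proof (rule eval_on_cong)
      fix y assume y: "y \<in> R - lower S - lower U"
      show "plug n g U (plug p h S a) y =
          ((\<lambda>x. (\<beta> ^^ (n + p - 2)) (a x))(Max U := eval_on g U (plug p h S a))) y"
      proof (cases "y = Max U")
        case False
        \<comment> \<open>The only remaining position of \<open>U\<close> is \<open>Max U\<close>, so the value of \<open>h\<close> is not seen directly by \<open>f\<close>.\<close>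
        then have "y \<noteq> Max S" using y nest by (auto simp: lower_def)
        then show ?thesis using False unfolding e by (simp add: plug_def funpow_add)
      qed (simp add: plug_def)
    qed (use R(1) in simp)
    then show "(case case x of (S, U) \<Rightarrow> (U \<union> S, S) of (V, S) \<Rightarrow>
        (- 1) ^ (crossings (lower V) (R - lower V) + crossings (lower S) (V - lower S)) *s
        eval_on f (R - lower V) ((\<lambda>x. (\<beta> ^^ (n + p - 2)) (a x))
          (Max V := eval_on g (V - lower S) (plug p h S a)))) = T x"
      unfolding x T_def prod.case facts(2,3) facts(5) unfolding facts(4) by simp
  next
    fix y assume "y \<in> Sigma (subsets_of_card R (n + p - 1)) (\<lambda>V. subsets_of_card V p)"
    then obtain V S where y: "y = (V, S)" and V: "V \<in> subsets_of_card R (n + p - 1)"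
      and S: "S \<in> subsets_of_card V p" by blast
    note facts = nested_blocks_converse[OF R(1) V S p n]
    show "(case case y of (V, S) \<Rightarrow> (S, V - lower S) of (S, U) \<Rightarrow> (U \<union> S, S)) = y"
      unfolding y using facts(4) by simp
    show "(case y of (V, S) \<Rightarrow> (S, V - lower S)) \<in> {(S, U) \<in> A. Max S \<in> U}"
      unfolding y A_def using facts by simp
  qed
  have parallel: "sum T {(S, U) \<in> A. Max S \<notin> U} = parallel_comp f n g p h R a"
    unfolding parallel_comp_def
  proof (rule sum.cong)
    show "{(S, U) \<in> A. Max S \<notin> U} =
        {(S, U). S \<in> subsets_of_card R p \<and> U \<in> subsets_of_card R n \<and> S \<inter> U = {}}"
    proof -
      have "U \<in> subsets_of_card (R - lower S) n \<and> Max S \<notin> U \<longleftrightarrow> U \<in> subsets_of_card R n \<and> S \<inter> U = {}"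
        if "S \<in> subsets_of_card R p" for S U
        using block_facts(3)[OF R(1) that p] by (auto simp: lower_def)
      then show ?thesis unfolding A_def by blast
    qed
  next
    fix x assume "x \<in> {(S, U). S \<in> subsets_of_card R p \<and> U \<in> subsets_of_card R n \<and> S \<inter> U = {}}"
    then obtain S U where x: "x = (S, U)" and S: "S \<in> subsets_of_card R p"
      and U: "U \<in> subsets_of_card R n" and disj: "S \<inter> U = {}" by blast
    note S' = block_facts[OF R(1) S p] and U' = block_facts[OF R(1) U n]
    have ne: "Max S \<noteq> Max U" using S'(3) U'(3) disj by auto
    have "eval_on g U (plug p h S a) = eval_on g U (\<lambda>x. (\<beta> ^^ (p - 1)) (a x))"
      using U'(1) S'(3) disj by (intro eval_on_cong) (auto simp: plug_def)
    then have "plug n g U (plug p h S a) =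
        (\<lambda>x. (\<beta> ^^ (n - 1 + (p - 1))) (a x))
          (Max S := eval_on h S (\<lambda>x. (\<beta> ^^ (n - 1)) (a x)),
           Max U := eval_on g U (\<lambda>x. (\<beta> ^^ (p - 1)) (a x)))"
      using ne S cochain_funpow[OF h, of S] by (auto simp: plug_def funpow_add)
    then show "T x = (case x of (S, U) \<Rightarrow>
      (- 1) ^ (crossings (lower S) (R - lower S) + crossings (lower U) (R - lower S - lower U)) *s
      eval_on f (R - lower S - lower U)
        ((\<lambda>x. (\<beta> ^^ (n - 1 + (p - 1))) (a x))
          (Max S := eval_on h S (\<lambda>x. (\<beta> ^^ (n - 1)) (a x)),
           Max U := eval_on g U (\<lambda>x. (\<beta> ^^ (p - 1)) (a x)))))"
      unfolding x T_def by simp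
  qed
  have "subset_comp p (circ_l scale \<beta> m n f g) h R a = sum T A"
    unfolding iterated_comp_left[OF R m n p] A_def T_def ..
  also have "\<dots> = sum T {(S, U) \<in> A. Max S \<in> U} + sum T {(S, U) \<in> A. Max S \<notin> U}"
    using finA by (subst sum.union_disjoint[symmetric])
      (auto intro: finite_subset[of _ A] intro!: sum.cong)
  finally show ?thesis unfolding nested parallel .
qed

lemma circ_l_pre_Lie:
  assumes f: "f \<in> cochain m" and g: "g \<in> cochain n" and h: "h \<in> cochain p"
    and m: "m \<ge> 1" and n: "n \<ge> 1" and p: "p \<ge> 1"
  shows "circ_l scale \<beta> (m + n - 1) p (circ_l scale \<beta> m n f g) h
      - circ_l scale \<beta> m (n + p - 1) f (circ_l scale \<beta> n p g h) =
    fun_scale scale ((- 1) ^ ((n - 1) * (p - 1)))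
      (circ_l scale \<beta> (m + p - 1) n (circ_l scale \<beta> m p f h) g
        - circ_l scale \<beta> m (p + n - 1) f (circ_l scale \<beta> p n h g))"
proof
  fix as :: "'m list"
  let ?R = "{1..m + n + p - 2}" and ?a = "\<lambda>j. as ! (j - 1)"
  show "(circ_l scale \<beta> (m + n - 1) p (circ_l scale \<beta> m n f g) h
      - circ_l scale \<beta> m (n + p - 1) f (circ_l scale \<beta> n p g h)) as =
    fun_scale scale ((- 1) ^ ((n - 1) * (p - 1)))
      (circ_l scale \<beta> (m + p - 1) n (circ_l scale \<beta> m p f h) g
        - circ_l scale \<beta> m (p + n - 1) f (circ_l scale \<beta> p n h g)) as"
  proof (cases "length as = m + n + p - 2")
    case True
    have len: "m + n - 1 + p - 1 = m + n + p - 2" "m + (n + p - 1) - 1 = m + n + p - 2"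
      "m + p - 1 + n - 1 = m + n + p - 2" "m + (p + n - 1) - 1 = m + n + p - 2"
      using m n p by auto
    have eq: "circ_l scale \<beta> M N F G as = subset_comp N F G ?R ?a"
      if "M + N - 1 = m + n + p - 2" "M \<ge> 1" "N \<ge> 1" for M N F G
      using circ_l_eq_subset_comp[of as M N F G] that True by simp
    have pos: "m + n - 1 \<ge> 1" "n + p - 1 \<ge> 1" "m + p - 1 \<ge> 1" "p + n - 1 \<ge> 1"
      using m n p by auto
    have swap: "m + p + n - 2 = m + n + p - 2" by simp
    have assoc1: "circ_l scale \<beta> (m + n - 1) p (circ_l scale \<beta> m n f g) h as
        - circ_l scale \<beta> m (n + p - 1) f (circ_l scale \<beta> n p g h) as = parallel_comp f n g p h ?R ?a"
      unfolding eq[OF len(1) pos(1) p] eq[OF len(2) m pos(2)]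
      using associator_eq_parallel_comp[OF cochain_multilinear[OF f] h, of ?R n g ?a] m n p
      by simp
    have assoc2: "circ_l scale \<beta> (m + p - 1) n (circ_l scale \<beta> m p f h) g as
        - circ_l scale \<beta> m (p + n - 1) f (circ_l scale \<beta> p n h g) as = parallel_comp f p h n g ?R ?a"
      unfolding eq[OF len(3) pos(3) n] eq[OF len(4) m pos(4)]
      using associator_eq_parallel_comp[OF cochain_multilinear[OF f] g, of ?R p h ?a] m n p
      by (simp add: swap)
    show ?thesis
      using assoc1 assoc2 parallel_comp_swap[of ?R n p f g h ?a] n p
      by (simp add: fun_scale_def)
  next
    case False
    then show ?thesis using m n p by (auto simp: circ_l_def fun_scale_def)
  qed
qed

end

section \<open>The graded algebra\<close>

lemma fun_scale_apply: "fun_scale scale c f x = scale c (f x)"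
  by (simp add: fun_scale_def)

lemma sum_fun_apply: "(\<Sum>i\<in>I. f i) x = (\<Sum>i\<in>I. f i x)"
  by (induction I rule: infinite_finite_induct) simp_all

context hom_space
begin

lemma multilinear_0: "multilinear_on_lists scale k 0"
  by (simp add: multilinear_on_lists_def lin_iff)

lemma multilinear_plus:
  "multilinear_on_lists scale k f \<Longrightarrow> multilinear_on_lists scale k g \<Longrightarrow>
    multilinear_on_lists scale k (f + g)"
  by (simp add: multilinear_on_lists_def lin_iff scale_right_distrib)

lemma multilinear_fun_scale:
  "multilinear_on_lists scale k f \<Longrightarrow> multilinear_on_lists scale k (fun_scale scale c f)"
  by (simp add: multilinear_on_lists_def fun_scale_apply lin_scale_fun)

lemma cochain_0: "0 \<in> cochain k"
  using lin_0[OF linear_beta] by (simp add: cochains_def multilinear_0)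

lemma cochain_plus: "f \<in> cochain k \<Longrightarrow> g \<in> cochain k \<Longrightarrow> f + g \<in> cochain k"
  using linear_beta by (simp add: cochains_def multilinear_plus lin_iff)

lemma cochain_fun_scale: "f \<in> cochain k \<Longrightarrow> fun_scale scale c f \<in> cochain k"
  using linear_beta by (simp add: cochains_def multilinear_fun_scale fun_scale_apply lin_iff)

lemma cochain_multilinear_any_arity:
  assumes "f \<in> cochain k"
  shows "multilinear_on_lists scale l f"
proof (cases "l = k")
  case False
  then have "lin (\<lambda>x. f (as[i := x]))" if "length as = l" for as i
    using assms that by (simp add: cochains_def lin_iff)
  then show ?thesis by (simp add: multilinear_on_lists_def)
qed (use assms cochain_multilinear in simp)

lemma vector_space_fun_scale: "vector_space (fun_scale scale)"
  by unfold_locales (auto simp: fun_scale_def scale_right_distrib scale_left_distrib)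

text \<open>
  Right additivity of the product needs multilinearity of the left factor. This survives in sums of
  cochains of different arities because a cochain vanishes, and so is trivially multilinear, on lists of
  any other length.
\<close>

lemma span_cochains_multilinear:
  assumes "f \<in> module.span (fun_scale scale) (\<Union>d. cochain (d + 1))"
  shows "multilinear_on_lists scale k f"
proof -
  interpret F: vector_space "fun_scale scale" by (rule vector_space_fun_scale)
  have "F.subspace {f. multilinear_on_lists scale k f}"
    by (rule F.subspaceI) (simp_all add: multilinear_0 multilinear_plus multilinear_fun_scale)
  moreover have "(\<Union>d. cochain (d + 1)) \<subseteq> {f. multilinear_on_lists scale k f}"
    using cochain_multilinear_any_arity by blast
  ultimately show ?thesis using F.span_minimal assms by blast
qed

lemma circ_total_eq_sum_subset_comp:
  "circ_total scale \<beta> f g as =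
    (\<Sum>n\<in>{1..length as}. subset_comp n f g {1..length as} (\<lambda>j. as ! (j - 1)))"
  unfolding circ_total_def
proof (rule sum.cong[OF refl])
  fix n assume "n \<in> {1..length as}"
  then have "length as = length as + 1 - n + n - 1" "length as + 1 - n \<ge> 1" "n \<ge> 1" by auto
  from circ_l_eq_subset_comp[OF this] this(1)
  show "circ_l scale \<beta> (length as + 1 - n) n f g as =
    subset_comp n f g {1..length as} (\<lambda>j. as ! (j - 1))" by simp
qed

lemma subset_comp_plus_left: "subset_comp n (f + f') g R a = subset_comp n f g R a + subset_comp n f' g R a"
  by (simp add: subset_comp_def eval_on_plus scale_right_distrib sum.distrib)

lemma subset_comp_scale_left: "subset_comp n (fun_scale scale c f) g R a = c *s subset_comp n f g R a"
  by (simp add: subset_comp_def eval_on_fun_scale scale_sum_right mult.commute)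

lemma subset_comp_plus_right:
  assumes f: "\<And>k. multilinear_on_lists scale k f" and R: "finite R" and n: "n \<ge> 1"
  shows "subset_comp n f (g + g') R a = subset_comp n f g R a + subset_comp n f g' R a"
  unfolding subset_comp_def sum.distrib[symmetric]
proof (rule sum.cong[OF refl])
  fix S assume S: "S \<in> subsets_of_card R n"
  have "lin (\<lambda>v. eval_on f (R - lower S) ((\<lambda>x. (\<beta> ^^ (n - 1)) (a x))(Max S := v)))"
    by (rule lin_eval_on_plug_slot[OF f R n S])
  then show "(- 1) ^ crossings (lower S) (R - lower S) *s eval_on f (R - lower S) (plug n (g + g') S a) =
    (- 1) ^ crossings (lower S) (R - lower S) *s eval_on f (R - lower S) (plug n g S a) +
    (- 1) ^ crossings (lower S) (R - lower S) *s eval_on f (R - lower S) (plug n g' S a)"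
    by (simp add: plug_def eval_on_plus lin_iff scale_right_distrib)
qed

lemma subset_comp_scale_right:
  assumes f: "\<And>k. multilinear_on_lists scale k f" and R: "finite R" and n: "n \<ge> 1"
  shows "subset_comp n f (fun_scale scale c g) R a = c *s subset_comp n f g R a"
  unfolding subset_comp_def scale_sum_right
proof (rule sum.cong[OF refl])
  fix S assume S: "S \<in> subsets_of_card R n"
  have "lin (\<lambda>v. eval_on f (R - lower S) ((\<lambda>x. (\<beta> ^^ (n - 1)) (a x))(Max S := v)))"
    by (rule lin_eval_on_plug_slot[OF f R n S])
  then show "(- 1) ^ crossings (lower S) (R - lower S) *s eval_on f (R - lower S) (plug n (fun_scale scale c g) S a) =
    c *s (- 1) ^ crossings (lower S) (R - lower S) *s eval_on f (R - lower S) (plug n g S a)"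
    by (simp add: plug_def eval_on_fun_scale lin_iff mult.commute)
qed

text \<open>
  A mismatch in the arity of \<open>g\<close> puts the value \<open>0\<close> into a slot of \<open>f\<close>; a mismatch in the arity of \<open>f\<close>
  gives \<open>0\<close> directly. Hence only one term of the bilinear extension survives on homogeneous elements.
\<close>

lemma subset_comp_wrong_arity:
  assumes f: "f \<in> cochain m" and g: "g \<in> cochain n" and R: "finite R" and n': "n' \<ge> 1"
    and ne: "n' \<noteq> n \<or> card R \<noteq> m + n - 1" and n: "n \<ge> 1" and le: "n' \<le> card R"
  shows "subset_comp n' f g R a = 0"
  unfolding subset_comp_def
proof (intro sum.neutral ballI)
  fix S assume S: "S \<in> subsets_of_card R n'"
  note facts = block_facts[OF R S n']
  have "eval_on f (R - lower S) (plug n' g S a) = 0"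
  proof (cases "n' = n")
    case True
    then have "card (R - lower S) \<noteq> m" using facts(8) ne n' le by auto
    then show ?thesis by (rule cochain_eval_on_eq_0[OF f])
  next
    case False
    have "lin (\<lambda>v. eval_on f (R - lower S) ((\<lambda>x. (\<beta> ^^ (n' - 1)) (a x))(Max S := v)))"
      by (rule lin_eval_on_plug_slot[OF cochain_multilinear_any_arity[OF f] R n' S])
    moreover have "eval_on g S a = 0" using False S by (intro cochain_eval_on_eq_0[OF g]) auto
    ultimately show ?thesis using lin_0 by (simp add: plug_def)
  qed
  then show "(- 1) ^ crossings (lower S) (R - lower S) *s eval_on f (R - lower S) (plug n' g S a) = 0"
    by simp
qed

lemma circ_total_cochains:
  assumes f: "f \<in> cochain m" and g: "g \<in> cochain n" and m: "m \<ge> 1" and n: "n \<ge> 1"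
  shows "circ_total scale \<beta> f g = circ_l scale \<beta> m n f g"
proof
  fix as :: "'m list"
  let ?t = "\<lambda>n'. subset_comp n' f g {1..length as} (\<lambda>j. as ! (j - 1))"
  show "circ_total scale \<beta> f g as = circ_l scale \<beta> m n f g as"
  proof (cases "length as = m + n - 1")
    case True
    have "circ_total scale \<beta> f g as = sum ?t {n}"
      unfolding circ_total_eq_sum_subset_comp
    proof (rule sum.mono_neutral_right)
      show "{n} \<subseteq> {1..length as}" using True m n by auto
      show "\<forall>n'\<in>{1..length as} - {n}. ?t n' = 0"
        using n by (auto intro!: subset_comp_wrong_arity[OF f g])
    qed simp
    then show ?thesis using circ_l_eq_subset_comp[OF True m n, of f g] True by simp
  next
    case False
    have "circ_total scale \<beta> f g as = 0"
      unfolding circ_total_eq_sum_subset_comp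
      using n False by (intro sum.neutral ballI subset_comp_wrong_arity[OF f g]) auto
    then show ?thesis using False by (simp add: circ_l_def)
  qed
qed

lemma graded_pre_Lie_algebra_cochains:
  "graded_pre_Lie_algebra (fun_scale scale) (\<lambda>d. cochain (d + 1)) (circ_total scale \<beta>)"
proof -
  interpret F: vector_space "fun_scale scale" by (rule vector_space_fun_scale)
  let ?V = "\<lambda>d. cochain (d + 1)" and ?mult = "circ_total scale \<beta>"
  have mult: "?mult f g = circ_l scale \<beta> (d + 1) (e + 1) f g" if "f \<in> ?V d" "g \<in> ?V e" for f g d e
    using circ_total_cochains[OF that] by simp
  have closed: "?mult f g \<in> ?V (d + e)" if "f \<in> ?V d" "g \<in> ?V e" for f g d e
    unfolding mult[OF that] using circ_l_cochain[OF that] by (simp add: add.commute)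
  show ?thesis
  proof unfold_locales
    show "F.subspace (?V d)" for d
      by (rule F.subspaceI) (simp_all add: cochain_0 cochain_plus cochain_fun_scale)
    show "v d = 0"
      if D: "finite D" "\<And>d. d \<in> D \<Longrightarrow> v d \<in> ?V d" "(\<Sum>d\<in>D. v d) = 0" "d \<in> D" for D v d
    proof
      fix as :: "'m list"
      show "v d as = 0 as"
      proof (cases "length as = d + 1")
        case True
        have "(\<Sum>e\<in>D. v e as) = (\<Sum>e\<in>{d}. v e as)"
          using D True by (intro sum.mono_neutral_right) (auto simp: cochains_def)
        then show ?thesis using D(3) by (simp flip: sum_fun_apply)
      qed (use D(2)[OF D(4)] in \<open>simp add: cochains_def\<close>)
    qed
    show "?mult (f + f') g = ?mult f g + ?mult f' g" for f f' g
      by (rule ext) (simp add: circ_total_eq_sum_subset_comp subset_comp_plus_left sum.distrib)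
    show "?mult (fun_scale scale c f) g = fun_scale scale c (?mult f g)" for c f g
      by (rule ext)
        (simp add: circ_total_eq_sum_subset_comp subset_comp_scale_left fun_scale_apply scale_sum_right)
    show "?mult f (g + g') = ?mult f g + ?mult f g'" if "f \<in> F.span (\<Union>d. ?V d)" for f g g'
      using subset_comp_plus_right[OF span_cochains_multilinear[OF that]]
      by (intro ext) (simp add: circ_total_eq_sum_subset_comp sum.distrib)
    show "?mult f (fun_scale scale c g) = fun_scale scale c (?mult f g)"
      if "f \<in> F.span (\<Union>d. ?V d)" for c f g
      using subset_comp_scale_right[OF span_cochains_multilinear[OF that]]
      by (intro ext) (simp add: circ_total_eq_sum_subset_comp fun_scale_apply scale_sum_right)
    show "?mult f g \<in> ?V (d + e)" if "f \<in> ?V d" "g \<in> ?V e" for f g d e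
      using that by (rule closed)
    show "?mult (?mult f g) h - ?mult f (?mult g h) =
        fun_scale scale ((- 1) ^ (e * r)) (?mult (?mult f h) g - ?mult f (?mult h g))"
      if f: "f \<in> ?V d" and g: "g \<in> ?V e" and h: "h \<in> ?V r" for f g h d e r
      using circ_l_pre_Lie[OF f g h] mult[OF closed[OF f g] h] mult[OF f closed[OF g h]]
        mult[OF closed[OF f h] g] mult[OF f closed[OF h g]] mult[OF f g] mult[OF g h] mult[OF f h]
        mult[OF h g]
      by (simp add: add.commute)
  qed
qed

end

theorem proposition3p3:
  fixes scale :: "'k::field_char_0 \<Rightarrow> 'm::ab_group_add \<Rightarrow> 'm"
    and \<beta> :: "'m \<Rightarrow> 'm"
  assumes "vector_space scale"
    and "Vector_Spaces.linear scale scale \<beta>"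
  shows "graded_pre_Lie_algebra (fun_scale scale) (\<lambda>d. cochains scale \<beta> (d + 1))
           (circ_total scale \<beta>) \<and>
         (\<forall>m \<ge> 1. \<forall>n \<ge> 1. \<forall>p \<ge> 1.
            \<forall>f \<in> cochains scale \<beta> m. \<forall>g \<in> cochains scale \<beta> n. \<forall>h \<in> cochains scale \<beta> p.
              circ_l scale \<beta> m n f g \<in> cochains scale \<beta> (m + n - 1) \<and>
              circ_total scale \<beta> f g = circ_l scale \<beta> m n f g \<and>
              circ_l scale \<beta> (m + n - 1) p (circ_l scale \<beta> m n f g) h
                - circ_l scale \<beta> m (n + p - 1) f (circ_l scale \<beta> n p g h) =
              fun_scale scale ((- 1) ^ ((n - 1) * (p - 1)))
                (circ_l scale \<beta> (m + p - 1) n (circ_l scale \<beta> m p f h) g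
                   - circ_l scale \<beta> m (p + n - 1) f (circ_l scale \<beta> p n h g)))"
proof -
  interpret hom_space scale \<beta>
    by (intro hom_space.intro hom_space_axioms.intro assms)
  show ?thesis
    using graded_pre_Lie_algebra_cochains circ_l_cochain circ_total_cochains circ_l_pre_Lie by blast
qed

end
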